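(* Let $T>0$. A state $W^0\in\widehat H^0(\mathbb R^2)$ is approximately controllable to a state $W^T\in\widehat H^0(\mathbb R^2)$ in the given time $T$ if and only if $$W^T-\frac1{4\pi T}e^{-\frac{|\cdot|^2}{4T}}*W^0\in\mathcal H.$$
   Context: $\mathbb R_+=(0,+\infty)$; function spaces (including the controls $L^\infty(0,T)$) are complex. $\widehat H^0(\mathbb R^2)$ is the subspace of $L^2(\mathbb R^2)$ (with the $L^2$ norm) of functions even with respect to $x_1$. $\mathcal H=\{f\in L^2(\mathbb R^2): \exists g\in L^2(\mathbb R_+),\ f(x)=g(|x|^2)\text{ a.e. on }\mathbb R^2\}$. For $W^0\in\widehat H^0(\mathbb R^2)$ and $u\in L^\infty(0,T)$ put $$\mathcal W_0(\cdot,T)=\frac1{4\pi T}e^{-\frac{|\cdot|^2}{4T}}*W^0,\qquad \mathcal W_u(x,T)=-\frac1\pi\int_0^T\frac1{2\xi}e^{-\frac{|x|^2}{4\xi}}u(T-\xi)\,d\xi .$$ Then $W(\cdot,T)=\mathcal W_0(\cdot,T)+\mathcal W_u(\cdot,T)$ is the state at time $T$ of the unique solution of the control system $W_t=\Delta W-2\delta u(t)$, $W(\cdot,0)=W^0$ on $\mathbb R^2$. Let $$\mathcal R_T(W^0)=\{V\in\widehat H^0(\mathbb R^2):\exists u\in L^\infty(0,T),\ V=\mathcal W_0(\cdot,T)+\mathcal W_u(\cdot,T)\}.$$ $W^0$ is approximately controllable to $W^T$ in time $T$ if $W^T\in\overline{\mathcal R_T(W^0)}$ (closure in $\widehat H^0(\mathbb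 R^2)$). *)

theory Defs
  imports "HOL-Analysis.Analysis"
begin

text \<open>
  Elements of the function spaces below are representatives (Lebesgue measurable functions), not
  equivalence classes. Every set of functions defined here is invariant under modification on null
  sets, so that equalities between elements of these spaces are stated almost everywhere.
\<close>

definition L2 :: "'a measure \<Rightarrow> ('a \<Rightarrow> complex) set" where
  "L2 M = {f \<in> borel_measurable M. integrable M (\<lambda>x. (cmod (f x))\<^sup>2)}"

text \<open>Only meaningful for functions in \<open>L2 M\<close>, since non-integrable functions have integral 0.\<close>

definition L2norm :: "'a measure \<Rightarrow> ('a \<Rightarrow> complex) \<Rightarrow> real" where
  "L2norm M f = sqrt (\<integral>x. (cmod (f x))\<^sup>2 \<partial>M)"

definition Linf :: "'a measure \<Rightarrow> ('a \<Rightarrow> complex) set" where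
  "Linf M = {f \<in> borel_measurable M. \<exists>C. AE x in M. cmod (f x) \<le> C}"

definition reflect1 :: "real^2 \<Rightarrow> real^2" where
  "reflect1 x = (\<chi> i. if i = 1 then - x $ 1 else x $ i)"

definition H0_hat :: "(real^2 \<Rightarrow> complex) set" where
  "H0_hat = {f \<in> L2 lebesgue. AE x in lebesgue. f (reflect1 x) = f x}"

definition H_radial :: "(real^2 \<Rightarrow> complex) set" where
  "H_radial = {f \<in> L2 lebesgue. \<exists>g \<in> L2 (lebesgue_on {0<..}).
     AE x in lebesgue. f x = g ((norm x)\<^sup>2)}"

definition heat_kernel :: "real \<Rightarrow> real^2 \<Rightarrow> complex" where
  "heat_kernel t x = of_real (1 / (4 * pi * t) * exp (- (norm x)\<^sup>2 / (4 * t)))"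

definition fun_conv :: "(real^2 \<Rightarrow> complex) \<Rightarrow> (real^2 \<Rightarrow> complex) \<Rightarrow> real^2 \<Rightarrow> complex" where
  "fun_conv f g x = (\<integral>y. f (x - y) * g y \<partial>lebesgue)"

definition free_state :: "real \<Rightarrow> (real^2 \<Rightarrow> complex) \<Rightarrow> real^2 \<Rightarrow> complex" where
  "free_state T W0 = fun_conv (heat_kernel T) W0"

definition control_state :: "real \<Rightarrow> (real \<Rightarrow> complex) \<Rightarrow> real^2 \<Rightarrow> complex" where
  "control_state T u x = - (1 / of_real pi) *
     (\<integral>\<xi>. of_real (1 / (2 * \<xi>) * exp (- (norm x)\<^sup>2 / (4 * \<xi>))) * u (T - \<xi>)
        \<partial>lebesgue_on {0<..<T})"

text \<open>
  The states at time \<open>T\<close> of \<open>W\<^sub>t = \<Delta>W - 2 \<delta> u(t)\<close>, \<open>W(\<cdot>, 0) = W0\<close>, given by the solution formula.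
\<close>

definition reachable :: "real \<Rightarrow> (real^2 \<Rightarrow> complex) \<Rightarrow> (real^2 \<Rightarrow> complex) set" where
  "reachable T W0 = {V \<in> H0_hat. \<exists>u \<in> Linf (lebesgue_on {0<..<T}).
     AE x in lebesgue. V x = free_state T W0 x + control_state T u x}"

definition H0_closure :: "(real^2 \<Rightarrow> complex) set \<Rightarrow> (real^2 \<Rightarrow> complex) set" where
  "H0_closure A = {f \<in> H0_hat. \<forall>\<epsilon>>0. \<exists>V \<in> A. L2norm lebesgue (\<lambda>x. V x - f x) < \<epsilon>}"

definition approx_controllable ::
    "real \<Rightarrow> (real^2 \<Rightarrow> complex) \<Rightarrow> (real^2 \<Rightarrow> complex) \<Rightarrow> bool" where
  "approx_controllable T W0 WT \<longleftrightarrow> WT \<in> H0_closure (reachable T W0)"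

end

(*
  The states reached from 0 are radial, x |-> k(|x|^2), and polar coordinates turn the Lebesgue
  measure of the plane into pi times that of the half-line under x |-> |x|^2. A limit of radial
  functions is radial because a subsequence converges almost everywhere. Conversely, pulses
  concentrating at a time xi0 < T produce the Gaussian exp(-q |x|^2), q = 1/(4 xi0) > 1/(4T), in
  the limit. With y = exp(-|x|^2), finite combinations of exp(-(q + i)|x|^2) are exp(-q |x|^2)
  times polynomials in y, so Weierstrass approximation, a Dynkin argument for indicators of Borel
  sets of y, and simple functions yield every radial L2 function.
  That the free state lies in L2 need not be proved: it is a difference of L2 functions, either
  from the target state or from a reachable one.
*)

theory Submission
  imports Defs
begin

section \<open>Polar coordinates\<close>

text \<open>Controls are bounded one by one, without a common bound. They form a vector space,
  pulses of height proportional to 1/\<delta> are admissible, and the states reached from 0 form a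
  subspace which the free state merely translates. A bounded control can still produce an unbounded
  state: for u = 1 it has a logarithmic singularity at the origin. Square integrability therefore
  rests on a majorant that is singular at s = 0, and the estimates are stated for s > 0 only. Pulses
  sit at some \<xi> < T, so only exponents above 1/(4T) are produced, and the factor exp(-q |x|^2)
  stays in every combination. It turns bounded functions of y into square integrable ones, so that
  bounded pointwise convergence in y becomes L2 convergence. It is compensated only at the end, by
  dividing the target by it before approximating by simple functions; the quotient may be unbounded,
  but multiplying back restores an L2 majorant.\<close>

lemma emeasure_radius_sq_less:
  "emeasure lborel {x :: real^2. - (norm x)\<^sup>2 > a} = ennreal (pi * max 0 (- a))"
proof (cases "a < 0")
  case True
  have "{x :: real^2. - (norm x)\<^sup>2 > a} = ball 0 (sqrt (- a))"
    using True by (auto simp: real_less_rsqrt intro: real_less_rsqrt dest: real_sqrt_less_mono)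
      (smt (verit) norm_ge_zero real_sqrt_abs real_sqrt_less_iff)
  then show ?thesis
    using True emeasure_ball[of "sqrt (- a)" "0 :: real^2"] by (simp add: unit_ball_vol_2)
next
  case False
  then have "{x :: real^2. - (norm x)\<^sup>2 > a} = {}"
    by (auto simp: not_less) (smt (verit) zero_le_power2)
  then show ?thesis using False by simp
qed

text \<open>The sign is what makes the uniqueness theorem applicable: it compares measures on
  half-lines \<open>{a<..}\<close> of finite measure. For |x|^2 their preimages would be complements
  of discs, of infinite area; for -|x|^2 they are discs.\<close>

lemma distr_minus_radius_sq:
  "distr lborel borel (\<lambda>x :: real^2. - (norm x)\<^sup>2)
     = density lborel (\<lambda>s. ennreal (pi * indicator {..<0} s))"
proof (rule measure_eqI_lessThan)
  have *: "emeasure (distr lborel borel (\<lambda>x :: real^2. - (norm x)\<^sup>2)) {a<..} = ennreal (pi * max 0 (- a))" for a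
    by (subst emeasure_distr) (auto simp: emeasure_radius_sq_less[symmetric] intro!: arg_cong2[where f=emeasure])
  show "emeasure (distr lborel borel (\<lambda>x :: real^2. - (norm x)\<^sup>2)) {a<..} < \<infinity>" for a
    by (simp add: *)
  have "emeasure (density lborel (\<lambda>s. ennreal (pi * indicator {..<0} s))) {a<..} = ennreal (pi * max 0 (- a))" for a :: real
  proof -
    have "emeasure (density lborel (\<lambda>s. ennreal (pi * indicator {..<0} s))) {a<..}
        = (\<integral>\<^sup>+s. ennreal pi * indicator {a<..<0} s \<partial>lborel)"
      by (subst emeasure_density) (auto intro!: nn_integral_cong split: split_indicator)
    also have "\<dots> = ennreal pi * emeasure lborel {a<..<0}"
      by (simp add: nn_integral_cmult)
    also have "\<dots> = ennreal (pi * max 0 (- a))"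
      by (cases "a \<le> 0") (auto simp: ennreal_mult'[symmetric] max_def)
    finally show ?thesis .
  qed
  then show "emeasure (distr lborel borel (\<lambda>x :: real^2. - (norm x)\<^sup>2)) {a<..}
      = emeasure (density lborel (\<lambda>s. ennreal (pi * indicator {..<0} s))) {a<..}" for a
    by (simp add: *)
qed auto

lemma distr_radius_sq:
  "distr lborel borel (\<lambda>x :: real^2. (norm x)\<^sup>2)
     = density lborel (\<lambda>s. ennreal (pi * indicator {0<..} s))"
proof -
  have "distr lborel borel (\<lambda>x :: real^2. (norm x)\<^sup>2)
      = distr (distr lborel borel (\<lambda>x :: real^2. - (norm x)\<^sup>2)) borel uminus"
    by (subst distr_distr) (auto simp: o_def)
  also have "\<dots> = distr (density lborel (\<lambda>s. ennreal (pi * indicator {0<..} (- s)))) borel uminus"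
    unfolding distr_minus_radius_sq by (intro arg_cong2[where f="\<lambda>M. distr M borel"] density_cong) (auto split: split_indicator)
  also have "\<dots> = density (distr lborel borel uminus) (\<lambda>s. ennreal (pi * indicator {0<..} s))"
    by (subst density_distr) auto
  finally show ?thesis by (simp add: lborel_distr_uminus)
qed

lemma integrable_radial_iff:
  fixes k :: "real \<Rightarrow> real"
  assumes [measurable]: "k \<in> borel_measurable borel"
  shows "integrable lebesgue (\<lambda>x :: real^2. k ((norm x)\<^sup>2)) \<longleftrightarrow> set_integrable lborel {0<..} k"
proof -
  have "integrable lebesgue (\<lambda>x :: real^2. k ((norm x)\<^sup>2)) \<longleftrightarrow> integrable lborel (\<lambda>x :: real^2. k ((norm x)\<^sup>2))"
    by (rule integrable_completion) measurable
  also have "\<dots> \<longleftrightarrow> integrable (distr lborel borel (\<lambda>x :: real^2. (norm x)\<^sup>2)) k"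
    by (rule integrable_distr_eq[symmetric]) auto
  also have "\<dots> \<longleftrightarrow> integrable lborel (\<lambda>s. (pi * indicator {0<..} s) *\<^sub>R k s)"
    unfolding distr_radius_sq by (rule integrable_density) auto
  also have "\<dots> \<longleftrightarrow> set_integrable lborel {0<..} k"
    unfolding set_integrable_def by (simp add: mult.assoc)
  finally show ?thesis .
qed

text \<open>\<open>P\<close> is an arbitrary predicate, so a Borel null set \<open>N\<close>
  covering its failures is pulled back to the plane instead. The origin is removed separately,
  because the hypothesis is silent at s = 0.\<close>

lemma AE_radial:
  assumes "AE s in lborel. s > 0 \<longrightarrow> P s"
  shows "AE x :: real^2 in lebesgue. P ((norm x)\<^sup>2)"
proof -
  obtain N where N: "{s. \<not> (s > 0 \<longrightarrow> P s)} \<subseteq> N" "N \<in> null_sets lborel"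
    using assms by (auto simp: eventually_ae_filter)
  have "N \<in> null_sets (distr lborel borel (\<lambda>x :: real^2. (norm x)\<^sup>2))"
  proof -
    have "AE s in lborel. s \<notin> N" using N by (rule_tac AE_not_in)
    then have "AE s in distr lborel borel (\<lambda>x :: real^2. (norm x)\<^sup>2). s \<notin> N"
      unfolding distr_radius_sq by (subst AE_density) auto
    then show ?thesis using N(2) by (subst AE_iff_null_sets) auto
  qed
  then have "AE s in distr lborel borel (\<lambda>x :: real^2. (norm x)\<^sup>2). s \<notin> N"
    by (rule AE_not_in)
  then have 1: "AE x :: real^2 in lborel. (norm x)\<^sup>2 \<notin> N"
    using N(2) by (subst (asm) AE_distr_iff) auto
  have 2: "AE x :: real^2 in lborel. x \<noteq> 0" by (rule AE_lborel_singleton)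
  have "AE x :: real^2 in lborel. P ((norm x)\<^sup>2)"
    using 1 2
  proof eventually_elim
    case (elim x)
    then have "(norm x)\<^sup>2 > 0" by simp
    then show ?case using N(1) elim(1) by blast
  qed
  then show ?thesis by (rule AE_completion)
qed

section \<open>Square-integrable functions and bounded controls\<close>

text \<open>Stands in for the triangle inequality of the L2 norm: errors are measured by squared
  integrals throughout, where the factor 2 is harmless.\<close>

lemma cmod_add_sq_le: "(cmod (a + b))\<^sup>2 \<le> 2 * (cmod a)\<^sup>2 + 2 * (cmod b)\<^sup>2"
proof -
  have "(cmod (a + b))\<^sup>2 \<le> (cmod a + cmod b)\<^sup>2"
    by (intro power_mono norm_triangle_ineq) auto
  also have "\<dots> \<le> 2 * (cmod a)\<^sup>2 + 2 * (cmod b)\<^sup>2"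
    using sum_squares_ge_zero[of "cmod a - cmod b" 0] by (simp add: power2_eq_square algebra_simps)
  finally show ?thesis .
qed

lemma L2_measurable: "f \<in> L2 M \<Longrightarrow> f \<in> borel_measurable M"
  and L2_integrable: "f \<in> L2 M \<Longrightarrow> integrable M (\<lambda>x. (cmod (f x))\<^sup>2)"
  by (auto simp: L2_def)

lemma L2_bound:
  assumes "f \<in> borel_measurable M" "integrable M w" "AE x in M. (cmod (f x))\<^sup>2 \<le> w x"
  shows "f \<in> L2 M"
  unfolding L2_def using assms
  by (auto intro!: Bochner_Integration.integrable_bound[OF assms(2)] elim!: eventually_mono)

lemma L2_add: "f \<in> L2 M \<Longrightarrow> g \<in> L2 M \<Longrightarrow> (\<lambda>x. f x + g x) \<in> L2 M"
  by (rule L2_bound[where w="\<lambda>x. 2 * (cmod (f x))\<^sup>2 + 2 * (cmod (g x))\<^sup>2"], rule borel_measurable_add)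
    (simp_all add: cmod_add_sq_le L2_integrable L2_measurable)

lemma L2_cmult: "f \<in> L2 M \<Longrightarrow> (\<lambda>x. c * f x) \<in> L2 M"
  by (auto simp: L2_def norm_mult power_mult_distrib)

lemma L2_diff: "f \<in> L2 M \<Longrightarrow> g \<in> L2 M \<Longrightarrow> (\<lambda>x. f x - g x) \<in> L2 M"
  using L2_add[of f M "\<lambda>x. (- 1) * g x"] L2_cmult[of g M "- 1"] by simp

text \<open>Completeness of Lebesgue measure: preimages of a Borel set under the two functions
  differ only inside a null set.\<close>

lemma measurable_lebesgue_cong_AE:
  assumes "f \<in> borel_measurable lebesgue" "AE x in lebesgue. g x = f x"
  shows "g \<in> borel_measurable lebesgue"
proof (rule measurableI)
  fix A :: "'b set" assume "A \<in> sets borel"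
  then have "f -` A \<inter> space lebesgue \<in> sets lebesgue" using assms(1) by (rule measurable_sets[rotated])
  then show "g -` A \<inter> space lebesgue \<in> sets lebesgue"
    by (rule completion.in_sets_AE[rotated]) (use assms(2) in \<open>auto elim!: eventually_mono\<close>)
qed auto

lemma L2_cong_AE:
  assumes "f \<in> L2 lebesgue" "AE x in lebesgue. g x = f x"
  shows "g \<in> L2 lebesgue"
proof -
  have "g \<in> borel_measurable lebesgue"
    using L2_measurable[OF assms(1)] assms(2) by (rule measurable_lebesgue_cong_AE)
  then show ?thesis
    by (rule L2_bound[OF _ L2_integrable[OF assms(1)]]) (use assms(2) in \<open>auto elim!: eventually_mono\<close>)
qed

lemma integral_cmod_add_sq_le:
  assumes "f \<in> L2 M" "g \<in> L2 M"
  shows "(\<integral>x. (cmod (f x + g x))\<^sup>2 \<partial>M) \<le> 2 * (\<integral>x. (cmod (f x))\<^sup>2 \<partial>M) + 2 * (\<integral>x. (cmod (g x))\<^sup>2 \<partial>M)"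
proof -
  have "(\<integral>x. (cmod (f x + g x))\<^sup>2 \<partial>M) \<le> (\<integral>x. 2 * (cmod (f x))\<^sup>2 + 2 * (cmod (g x))\<^sup>2 \<partial>M)"
    using L2_integrable[OF L2_add[OF assms]] L2_integrable[OF assms(1)] L2_integrable[OF assms(2)]
    by (intro integral_mono) (auto simp: cmod_add_sq_le)
  then show ?thesis
    using L2_integrable[OF assms(1)] L2_integrable[OF assms(2)] by simp
qed

section \<open>Time reversal and linear combinations of controls\<close>

lemma AE_lebesgue_reverse:
  assumes "AE x in lebesgue. P (x :: real)"
  shows "AE x in lebesgue. P (t - x)"
proof -
  have "AE x in lborel. P x" using assms by (simp add: AE_completion_iff)
  then obtain N where N: "{x. \<not> P x} \<subseteq> N" "N \<in> null_sets lborel"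
    by (auto simp: eventually_ae_filter)
  have [measurable]: "N \<in> sets borel" using N(2) by auto
  have "AE x in lborel. t + (-1) * x \<notin> N"
    using N(2) by (intro AE_borel_affine AE_not_in) auto
  then have "AE x in lborel. P (t - x)"
    using N(1) by (auto elim!: eventually_mono)
  then show ?thesis by (rule AE_completion)
qed

text \<open>The solution formula evaluates the control at T - \<xi>. After extension by zero the
  control lives on the whole line, where it can be composed with the affine reflection, and
  \<open>{0<..<T}\<close> is mapped to itself.\<close>

lemma Linf_reverse:
  fixes T :: real
  assumes "u \<in> Linf (lebesgue_on {0<..<T})"
  shows "(\<lambda>\<xi>. u (T - \<xi>)) \<in> Linf (lebesgue_on {0<..<T})"
proof -
  let ?S = "{0<..<T}"
  have S: "?S \<in> sets lebesgue" by (intro sets_completionI_sets) simp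
  have "u \<in> borel_measurable (lebesgue_on ?S)" using assms by (simp add: Linf_def)
  then have "(\<lambda>x. if x \<in> ?S then u x else 0) \<in> borel_measurable lebesgue"
    by (subst borel_measurable_if[OF S])
  moreover have "(\<lambda>x. T - x) \<in> lebesgue \<rightarrow>\<^sub>M lebesgue"
    using lebesgue_affine_measurable[of "\<lambda>_::real. -1" T] by (simp add: algebra_simps)
  ultimately have "(\<lambda>x. if T - x \<in> ?S then u (T - x) else 0) \<in> borel_measurable lebesgue"
    using measurable_compose by blast
  also have "(\<lambda>x. if T - x \<in> ?S then u (T - x) else 0) = (\<lambda>x. if x \<in> ?S then u (T - x) else 0)"
    by auto
  finally have 1: "(\<lambda>\<xi>. u (T - \<xi>)) \<in> borel_measurable (lebesgue_on ?S)"
    by (subst (asm) borel_measurable_if[OF S])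
  obtain C where "AE x in lebesgue_on ?S. cmod (u x) \<le> C" using assms by (auto simp: Linf_def)
  then have "AE x in lebesgue. x \<in> ?S \<longrightarrow> cmod (u x) \<le> C"
    by (simp add: AE_restrict_space_iff)
  then have "AE x in lebesgue. T - x \<in> ?S \<longrightarrow> cmod (u (T - x)) \<le> C"
    by (rule AE_lebesgue_reverse)
  then have "AE x in lebesgue_on ?S. cmod (u (T - x)) \<le> C"
    by (simp add: AE_restrict_space_iff conj_commute)
  with 1 show ?thesis by (auto simp: Linf_def)
qed

lemma Linf_linear:
  assumes "u \<in> Linf M" "v \<in> Linf M"
  shows "(\<lambda>x. c * u x + v x) \<in> Linf M"
proof -
  obtain A B where "AE x in M. cmod (u x) \<le> A" "AE x in M. cmod (v x) \<le> B"
    using assms by (auto simp: Linf_def)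
  then have "AE x in M. cmod (c * u x + v x) \<le> cmod c * A + B"
    by eventually_elim
      (metis add_mono mult_left_mono norm_ge_zero norm_mult norm_triangle_ineq order_trans)
  then show ?thesis using assms by (auto simp: Linf_def)
qed

section \<open>A majorant for the heat factor\<close>

text \<open>
  The exponent \<open>-1/4\<close> balances two needs: the remaining \<open>\<xi> powr (-3/4)\<close> is integrable at \<open>0\<close>, and
  the square of the weight, of order \<open>s powr (-1/2)\<close>, is too.
\<close>

definition singular_weight :: "real \<Rightarrow> real \<Rightarrow> real" where
  "singular_weight T s = (s / 8) powr (- 1 / 4) * exp (- s / (8 * T))"

text \<open>With y = s/(8\<xi>) the exponential is exp(-y) * exp(-y). One half is traded for a
  power, exp(-y) \<le> y^(-1/4), which weakens the factor 1/\<xi> to an integrable one; the other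
  half keeps exponential decay in s that is uniform over \<xi> < T.\<close>

lemma heat_factor_le:
  fixes s \<xi> T :: real
  assumes "s > 0" "0 < \<xi>" "\<xi> < T"
  shows "1 / (2 * \<xi>) * exp (- s / (4 * \<xi>)) \<le> singular_weight T s * \<xi> powr (- 3 / 4)"
proof -
  define y where "y = s / (8 * \<xi>)"
  have y: "y > 0" using assms by (simp add: y_def)
  have "ln y / 4 \<le> y"
    using ln_le_minus_one[OF y] y by (cases "ln y \<ge> 0") auto
  then have "exp (- y) \<le> exp (- (ln y / 4))" by simp
  also have "\<dots> = y powr (- 1 / 4)" using y by (simp add: powr_def)
  also have "\<dots> = (s / 8) powr (- 1 / 4) * \<xi> powr (1 / 4)"
    using assms by (simp add: y_def powr_divide powr_minus field_simps powr_mult)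
  finally have a: "exp (- y) \<le> (s / 8) powr (- 1 / 4) * \<xi> powr (1 / 4)" .
  have b: "exp (- y) \<le> exp (- s / (8 * T))"
    using assms by (simp add: y_def field_simps)
  have "exp (- s / (4 * \<xi>)) = exp (- y) * exp (- y)"
    using assms by (simp add: y_def exp_add[symmetric] field_simps)
  also have "\<dots> \<le> ((s / 8) powr (- 1 / 4) * \<xi> powr (1 / 4)) * exp (- s / (8 * T))"
    by (intro mult_mono a b) auto
  finally have "1 / (2 * \<xi>) * exp (- s / (4 * \<xi>))
      \<le> 1 / \<xi> * (((s / 8) powr (- 1 / 4) * \<xi> powr (1 / 4)) * exp (- s / (8 * T)))"
    using assms by (intro mult_mono) (auto simp: field_simps)
  also have "\<dots> = singular_weight T s * (\<xi> powr (1 / 4) * \<xi> powr (- 1))"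
  proof -
    have "\<xi> powr (- 1) = 1 / \<xi>" using assms by (simp add: powr_minus_divide)
    then show ?thesis by (simp only: singular_weight_def mult_ac)
  qed
  also have "\<xi> powr (1 / 4) * \<xi> powr (- 1) = \<xi> powr (- 3 / 4)"
    by (subst powr_add[symmetric]) simp
  finally show ?thesis .
qed

text \<open>Up to a constant the square is s^(-1/2) exp(-s/(4T)), the modulus of the Gamma integrand
  at 1/2 with rate 1/(4T).\<close>

lemma set_integrable_singular_weight_sq:
  assumes "T > 0"
  shows "set_integrable lborel {0<..} (\<lambda>s. (singular_weight T s)\<^sup>2)"
proof -
  have "(\<lambda>t. complex_of_real t powr (1 / 2 - 1) / of_real (exp (1 / (4 * T) * t))) absolutely_integrable_on {0<..}"
    using absolutely_integrable_Gamma_integral[of "1 / 2" "1 / (4 * T)"] assms by simp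
  then have "(\<lambda>t. cmod (complex_of_real t powr (1 / 2 - 1) / of_real (exp (1 / (4 * T) * t)))) absolutely_integrable_on {0<..}"
    by (rule absolutely_integrable_norm[unfolded o_def])
  then have "(\<lambda>t. (1 / 8) powr (- 1 / 2) * cmod (complex_of_real t powr (1 / 2 - 1) / of_real (exp (1 / (4 * T) * t)))) absolutely_integrable_on {0<..}"
    by (rule set_integrable_mult_right)
  also have "?this \<longleftrightarrow> (\<lambda>s. (singular_weight T s)\<^sup>2) absolutely_integrable_on {0<..}"
  proof (intro set_integrable_cong refl)
    fix s :: real assume "s \<in> {0<..}"
    then have s: "s > 0" by simp
    have "((s / 8) powr (- 1 / 4))\<^sup>2 = (s / 8) powr (- 1 / 2)"
      using s by (simp add: power2_eq_square powr_add[symmetric])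
    also have "\<dots> = (1 / 8) powr (- 1 / 2) * s powr (- 1 / 2)"
      using s powr_mult[of "1 / 8" s "- 1 / 2"] by simp
    finally have 1: "((s / 8) powr (- 1 / 4))\<^sup>2 = (1 / 8) powr (- 1 / 2) * s powr (- 1 / 2)" .
    have 2: "(exp (- s / (8 * T)))\<^sup>2 = 1 / exp (1 / (4 * T) * s)"
    proof -
      have "(exp (- s / (8 * T)))\<^sup>2 = exp (2 * (- s / (8 * T)))" by (rule exp_double[symmetric])
      also have "2 * (- s / (8 * T)) = - (1 / (4 * T) * s)" using assms by simp
      finally show ?thesis by (simp only: exp_minus inverse_eq_divide)
    qed
    have 3: "cmod (complex_of_real s powr (1 / 2 - 1)) = s powr (- 1 / 2)"
      using s by (subst norm_powr_real_powr) auto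
    have 4: "cmod (complex_of_real (exp (1 / (4 * T) * s))) = exp (1 / (4 * T) * s)"
      by (simp only: norm_of_real abs_exp_cancel)
    show "(1 / 8) powr (- 1 / 2) * cmod (complex_of_real s powr (1 / 2 - 1) / of_real (exp (1 / (4 * T) * s)))
        = (singular_weight T s)\<^sup>2"
      unfolding norm_divide 3 4 singular_weight_def power_mult_distrib 1 2 by simp
  qed
  finally have "(\<lambda>s. (singular_weight T s)\<^sup>2) absolutely_integrable_on {0<..}" .
  then show ?thesis
    unfolding set_integrable_def
    by (subst (asm) integrable_completion) (auto simp: singular_weight_def)
qed

section \<open>The controlled part of the state\<close>

definition control_integrand :: "real \<Rightarrow> (real \<Rightarrow> complex) \<Rightarrow> real \<Rightarrow> real \<Rightarrow> complex" where
  "control_integrand T u s \<xi> = of_real (1 / (2 * \<xi>) * exp (- s / (4 * \<xi>))) * u (T - \<xi>)"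

definition control_profile :: "real \<Rightarrow> (real \<Rightarrow> complex) \<Rightarrow> real \<Rightarrow> complex" where
  "control_profile T u s = - (1 / of_real pi) * (\<integral>\<xi>. control_integrand T u s \<xi> \<partial>lebesgue_on {0<..<T})"

lemma control_state_eq_profile: "control_state T u x = control_profile T u ((norm x)\<^sup>2)"
  by (simp add: control_state_def control_profile_def control_integrand_def)

lemma control_integrand_measurable:
  assumes "u \<in> Linf (lebesgue_on {0<..<T})"
  shows "control_integrand T u s \<in> borel_measurable (lebesgue_on {0<..<T})"
proof -
  have [measurable]: "(\<lambda>\<xi>. u (T - \<xi>)) \<in> borel_measurable (lebesgue_on {0<..<T})"
    using Linf_reverse[OF assms] by (simp add: Linf_def)
  have [measurable]: "(\<lambda>\<xi>::real. \<xi>) \<in> borel_measurable (lebesgue_on {0<..<T})"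
    using id_borel_measurable_lebesgue_on[of "{0<..<T}"] by (simp add: id_def)
  show ?thesis unfolding control_integrand_def[abs_def] by measurable
qed

lemma control_profile_measurable:
  assumes "u \<in> Linf (lebesgue_on {0<..<T})"
  shows "control_profile T u \<in> borel_measurable borel"
proof -
  \<comment> \<open>Gives the sigma-finiteness behind the measurability of an integral in its
    parameter \<open>s\<close>.\<close>
  interpret finite_measure "lebesgue_on {0<..<T}"
    by (intro finite_measure_lebesgue_on) (simp add: lmeasurable_interval)
  have [measurable]: "(\<lambda>\<xi>. u (T - \<xi>)) \<in> borel_measurable (lebesgue_on {0<..<T})"
    using Linf_reverse[OF assms] by (simp add: Linf_def)
  have [measurable]: "(\<lambda>\<xi>::real. \<xi>) \<in> borel_measurable (lebesgue_on {0<..<T})"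
    using id_borel_measurable_lebesgue_on[of "{0<..<T}"] by (simp add: id_def)
  show ?thesis unfolding control_profile_def[abs_def] control_integrand_def
    by measurable
qed

text \<open>The constant is chosen before \<open>s\<close>: the resulting bound on the profile is
  later squared and integrated over all s > 0. The exceptional set of \<xi> may depend on
  \<open>s\<close>.\<close>

lemma control_integrand_bound:
  assumes T: "T > 0" and u: "u \<in> Linf (lebesgue_on {0<..<T})"
  shows "\<exists>C. \<forall>s>0. AE \<xi> in lebesgue_on {0<..<T}.
    cmod (control_integrand T u s \<xi>) \<le> C * singular_weight T s * \<xi> powr (- 3 / 4)"
proof -
  obtain C where C: "AE \<xi> in lebesgue_on {0<..<T}. cmod (u (T - \<xi>)) \<le> C"
    using Linf_reverse[OF u] unfolding Linf_def by blast
  have "AE \<xi> in lebesgue_on {0<..<T}. cmod (control_integrand T u s \<xi>) \<le> \<bar>C\<bar> * singular_weight T s * \<xi> powr (- 3 / 4)"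
    if s: "s > 0" for s
  proof -
    have "AE \<xi> in lebesgue_on {0<..<T}. \<xi> \<in> {0<..<T}"
      using AE_space[of "lebesgue_on {0<..<T}"] by simp
    with C show ?thesis
    proof eventually_elim
      case (elim \<xi>)
      have "cmod (control_integrand T u s \<xi>) = 1 / (2 * \<xi>) * exp (- s / (4 * \<xi>)) * cmod (u (T - \<xi>))"
        using elim by (simp add: control_integrand_def norm_mult norm_divide)
      also have "\<dots> \<le> (singular_weight T s * \<xi> powr (- 3 / 4)) * \<bar>C\<bar>"
        using elim s by (intro mult_mono heat_factor_le) (auto simp: singular_weight_def)
      finally show ?case by (simp add: mult_ac)
    qed
  qed
  then show ?thesis by blast
qed

lemma integrable_powr_on_Ioo:
  fixes T :: real
  assumes "T > 0"
  shows "integrable (lebesgue_on {0<..<T}) (\<lambda>\<xi>. \<xi> powr (- 3 / 4))"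
proof -
  have "(\<lambda>\<xi>. \<xi> powr (- 3 / 4)) absolutely_integrable_on {0..T}"
  proof (rule nonnegative_absolutely_integrable_1)
    show "(\<lambda>\<xi>. \<xi> powr (- 3 / 4)) integrable_on {0..T}"
      using assms by (intro integrable_on_powr_from_0) simp_all
  qed simp
  then have "(\<lambda>\<xi>. \<xi> powr (- 3 / 4)) absolutely_integrable_on {0<..<T}"
    by (rule set_integrable_subset) auto
  then show ?thesis
    by (simp add: set_integrable_def integrable_restrict_space)
qed

lemma control_integrand_integrable:
  assumes "T > 0" "u \<in> Linf (lebesgue_on {0<..<T})" "s > 0"
  shows "integrable (lebesgue_on {0<..<T}) (control_integrand T u s)"
proof -
  obtain C where C: "\<And>s. s > 0 \<Longrightarrow> AE \<xi> in lebesgue_on {0<..<T}.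
      cmod (control_integrand T u s \<xi>) \<le> C * singular_weight T s * \<xi> powr (- 3 / 4)"
    using control_integrand_bound[OF assms(1,2)] by blast
  show ?thesis
  proof (rule Bochner_Integration.integrable_bound)
    show "integrable (lebesgue_on {0<..<T}) (\<lambda>\<xi>. C * singular_weight T s * \<xi> powr (- 3 / 4))"
      by (intro integrable_mult_right integrable_powr_on_Ioo assms(1))
    show "AE \<xi> in lebesgue_on {0<..<T}.
        norm (control_integrand T u s \<xi>) \<le> norm (C * singular_weight T s * \<xi> powr (- 3 / 4))"
      using C[OF assms(3)] by (rule eventually_mono) (simp only: real_norm_def abs_ge_self order_trans[OF _ abs_ge_self])
  qed (rule control_integrand_measurable[OF assms(2)])
qed

lemma control_profile_bound:
  assumes T: "T > 0" and u: "u \<in> Linf (lebesgue_on {0<..<T})"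
  shows "\<exists>K. \<forall>s>0. cmod (control_profile T u s) \<le> K * singular_weight T s"
proof -
  obtain C where C: "\<And>s. s > 0 \<Longrightarrow> AE \<xi> in lebesgue_on {0<..<T}.
      cmod (control_integrand T u s \<xi>) \<le> C * singular_weight T s * \<xi> powr (- 3 / 4)"
    using control_integrand_bound[OF T u] by blast
  define J where "J = (\<integral>\<xi>. \<xi> powr (- 3 / 4) \<partial>lebesgue_on {0<..<T})"
  have "cmod (control_profile T u s) \<le> C * J / pi * singular_weight T s" if s: "s > 0" for s
  proof -
    have "cmod (\<integral>\<xi>. control_integrand T u s \<xi> \<partial>lebesgue_on {0<..<T})
        \<le> (\<integral>\<xi>. cmod (control_integrand T u s \<xi>) \<partial>lebesgue_on {0<..<T})"
      by (rule integral_norm_bound)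
    also have "\<dots> \<le> (\<integral>\<xi>. C * singular_weight T s * \<xi> powr (- 3 / 4) \<partial>lebesgue_on {0<..<T})"
      by (intro integral_mono_AE integrable_norm integrable_mult_right C s
        control_integrand_integrable[OF T u s] integrable_powr_on_Ioo[OF T])
    also have "\<dots> = C * singular_weight T s * J" by (simp add: J_def)
    finally have "cmod (control_profile T u s) \<le> 1 / pi * (C * singular_weight T s * J)"
      unfolding control_profile_def norm_mult by (intro mult_mono) (auto simp: norm_divide)
    then show ?thesis by (simp add: mult_ac)
  qed
  then show ?thesis by blast
qed

lemma L2_radial:
  assumes [measurable]: "k \<in> borel_measurable borel" and "set_integrable lborel {0<..} w"
    and "\<And>s. s > 0 \<Longrightarrow> (cmod (k s))\<^sup>2 \<le> w s"
  shows "(\<lambda>x :: real^2. k ((norm x)\<^sup>2)) \<in> L2 lebesgue"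
proof -
  have "set_integrable lborel {0<..} (\<lambda>s. (cmod (k s))\<^sup>2)"
    unfolding set_integrable_def
  proof (rule Bochner_Integration.integrable_bound[OF assms(2)[unfolded set_integrable_def]])
    have "norm (indicator {0<..} s *\<^sub>R (cmod (k s))\<^sup>2) \<le> norm (indicator {0<..} s *\<^sub>R w s)" for s :: real
      using assms(3)[of s] by (cases "s > 0") auto
    then show "AE s in lborel. norm (indicator {0<..} s *\<^sub>R (cmod (k s))\<^sup>2) \<le> norm (indicator {0<..} s *\<^sub>R w s)"
      by (rule AE_I2)
  qed simp
  then have "integrable lebesgue (\<lambda>x :: real^2. (cmod (k ((norm x)\<^sup>2)))\<^sup>2)"
    by (subst integrable_radial_iff[where k="\<lambda>s. (cmod (k s))\<^sup>2"]) auto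
  moreover have "(\<lambda>x :: real^2. k ((norm x)\<^sup>2)) \<in> borel_measurable lebesgue"
    by (intro measurable_completion) measurable
  ultimately show ?thesis by (simp add: L2_def)
qed

lemma control_state_L2:
  assumes T: "T > 0" and u: "u \<in> Linf (lebesgue_on {0<..<T})"
  shows "control_state T u \<in> L2 lebesgue"
proof -
  obtain K where K: "\<And>s. s > 0 \<Longrightarrow> cmod (control_profile T u s) \<le> K * singular_weight T s"
    using control_profile_bound[OF T u] by blast
  have "(\<lambda>x :: real^2. control_profile T u ((norm x)\<^sup>2)) \<in> L2 lebesgue"
  proof (rule L2_radial[where w="\<lambda>s. K\<^sup>2 * (singular_weight T s)\<^sup>2"])
    show "set_integrable lborel {0<..} (\<lambda>s. K\<^sup>2 * (singular_weight T s)\<^sup>2)"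
      using set_integrable_singular_weight_sq[OF T] by simp
    show "(cmod (control_profile T u s))\<^sup>2 \<le> K\<^sup>2 * (singular_weight T s)\<^sup>2" if "s > 0" for s
      using power_mono[OF K[OF that], of 2] by (simp add: power_mult_distrib)
  qed (rule control_profile_measurable[OF u])
  then show ?thesis by (simp add: control_state_eq_profile[abs_def])
qed

text \<open>
  At \<open>x = 0\<close> the integrand need not be integrable, so linearity can fail there (the integral is
  then the junk value 0).
\<close>

lemma control_state_linear:
  assumes "T > 0" "u \<in> Linf (lebesgue_on {0<..<T})" "v \<in> Linf (lebesgue_on {0<..<T})" "x \<noteq> 0"
  shows "control_state T (\<lambda>t. c * u t + v t) x = c * control_state T u x + control_state T v x"
proof -
  define s where "s = (norm x)\<^sup>2"
  have s: "s > 0" using assms(4) by (simp add: s_def)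
  have "control_integrand T (\<lambda>t. c * u t + v t) s
      = (\<lambda>\<xi>. c * control_integrand T u s \<xi> + control_integrand T v s \<xi>)"
    unfolding control_integrand_def by (intro ext) (simp only: distrib_left mult.left_commute)
  then have "(\<integral>\<xi>. control_integrand T (\<lambda>t. c * u t + v t) s \<xi> \<partial>lebesgue_on {0<..<T})
      = c * (\<integral>\<xi>. control_integrand T u s \<xi> \<partial>lebesgue_on {0<..<T})
        + (\<integral>\<xi>. control_integrand T v s \<xi> \<partial>lebesgue_on {0<..<T})"
    using control_integrand_integrable[OF assms(1) _ s] assms(2,3) by simp
  then show ?thesis
    by (simp add: control_state_eq_profile control_profile_def s_def[symmetric] algebra_simps)
qed

section \<open>Approximation by controlled states\<close>

text \<open>The L2 closure of the states reached from 0, with the squared distance to avoid roots.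
  Membership in \<open>L2 lebesgue\<close> is part of it because a non-integrable square would have
  integral 0 and pass as arbitrarily small.\<close>

definition approximable :: "real \<Rightarrow> (real^2 \<Rightarrow> complex) \<Rightarrow> bool" where
  "approximable T f \<longleftrightarrow> f \<in> L2 lebesgue \<and>
     (\<forall>\<epsilon>>0. \<exists>u \<in> Linf (lebesgue_on {0<..<T}). (\<integral>x. (cmod (control_state T u x - f x))\<^sup>2 \<partial>lebesgue) < \<epsilon>)"

lemma approximable_L2: "approximable T f \<Longrightarrow> f \<in> L2 lebesgue"
  by (simp add: approximable_def)

lemma approximableD:
  assumes "approximable T f" "\<epsilon> > 0"
  shows "\<exists>u \<in> Linf (lebesgue_on {0<..<T}). (\<integral>x. (cmod (control_state T u x - f x))\<^sup>2 \<partial>lebesgue) < \<epsilon>"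
  using assms by (simp add: approximable_def)

lemma approximable_control_state:
  assumes "T > 0" "u \<in> Linf (lebesgue_on {0<..<T})"
  shows "approximable T (control_state T u)"
  using control_state_L2[OF assms] assms(2) by (auto simp: approximable_def intro!: bexI[of _ u])

lemma approximable_linear:
  assumes T: "T > 0" and f: "approximable T f" and g: "approximable T g"
  shows "approximable T (\<lambda>x. c * f x + g x)"
  unfolding approximable_def
proof (intro conjI allI impI)
  show "(\<lambda>x. c * f x + g x) \<in> L2 lebesgue"
    by (intro L2_add L2_cmult approximable_L2[OF f] approximable_L2[OF g])
  fix \<epsilon> :: real assume \<epsilon>: "\<epsilon> > 0"
  \<comment> \<open>The error is at most twice the error of \<open>g\<close> plus 2|c|^2 times the
    error of \<open>f\<close>. Each share must be at most \<epsilon>/2; the summand 1 keeps the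
    divisor positive when c = 0.\<close>
  have "(cmod c)\<^sup>2 + 1 > 0" by (simp add: add_nonneg_pos)
  then have "\<epsilon> / (4 * ((cmod c)\<^sup>2 + 1)) > 0" using \<epsilon> by simp
  then obtain u where u: "u \<in> Linf (lebesgue_on {0<..<T})"
    and u': "(\<integral>x. (cmod (control_state T u x - f x))\<^sup>2 \<partial>lebesgue) < \<epsilon> / (4 * ((cmod c)\<^sup>2 + 1))"
    using approximableD[OF f] by blast
  obtain v where v: "v \<in> Linf (lebesgue_on {0<..<T})"
    and v': "(\<integral>x. (cmod (control_state T v x - g x))\<^sup>2 \<partial>lebesgue) < \<epsilon> / 4"
    using approximableD[OF g, of "\<epsilon> / 4"] \<epsilon> by auto
  let ?w = "\<lambda>t. c * u t + v t"
  let ?U = "\<lambda>x. control_state T u x - f x" and ?V = "\<lambda>x. control_state T v x - g x"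
  have w: "?w \<in> Linf (lebesgue_on {0<..<T})" by (rule Linf_linear[OF u v])
  have U: "?U \<in> L2 lebesgue" and V: "?V \<in> L2 lebesgue"
    by (intro L2_diff control_state_L2 T u v approximable_L2[OF f] approximable_L2[OF g])+
  have D: "(\<lambda>x. control_state T ?w x - (c * f x + g x)) \<in> L2 lebesgue"
    by (intro L2_diff control_state_L2 T w \<open>(\<lambda>x. c * f x + g x) \<in> L2 lebesgue\<close>)
  have cU: "(\<lambda>x. c * ?U x) \<in> L2 lebesgue" by (rule L2_cmult[OF U])
  have "AE x :: real^2 in lebesgue. x \<noteq> 0"
    by (rule AE_completion) (rule AE_lborel_singleton)
  then have "AE x in lebesgue. (cmod (control_state T ?w x - (c * f x + g x)))\<^sup>2 = (cmod (c * ?U x + ?V x))\<^sup>2"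
  proof eventually_elim
    case (elim x)
    have "control_state T ?w x - (c * f x + g x) = c * ?U x + ?V x"
      unfolding control_state_linear[OF T u v elim] by (simp add: right_diff_distrib)
    then show ?case by (simp only:)
  qed
  then have "(\<integral>x. (cmod (control_state T ?w x - (c * f x + g x)))\<^sup>2 \<partial>lebesgue)
      = (\<integral>x. (cmod (c * ?U x + ?V x))\<^sup>2 \<partial>lebesgue)"
    by (intro integral_cong_AE borel_measurable_integrable L2_integrable D L2_add[OF cU V])
  also have "\<dots> \<le> 2 * (\<integral>x. (cmod (c * ?U x))\<^sup>2 \<partial>lebesgue) + 2 * (\<integral>x. (cmod (?V x))\<^sup>2 \<partial>lebesgue)"
    by (rule integral_cmod_add_sq_le[OF cU V])
  also have "(\<integral>x. (cmod (c * ?U x))\<^sup>2 \<partial>lebesgue) = (cmod c)\<^sup>2 * (\<integral>x. (cmod (?U x))\<^sup>2 \<partial>lebesgue)"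
    by (simp add: norm_mult power_mult_distrib)
  also have "\<dots> \<le> (cmod c)\<^sup>2 * (\<epsilon> / (4 * ((cmod c)\<^sup>2 + 1)))"
    using u' by (intro mult_left_mono) auto
  also have "\<dots> \<le> \<epsilon> / 4"
    using \<epsilon> \<open>(cmod c)\<^sup>2 + 1 > 0\<close> by (simp add: field_simps)
  finally have "(\<integral>x. (cmod (control_state T ?w x - (c * f x + g x)))\<^sup>2 \<partial>lebesgue) < \<epsilon>"
    using v' by simp
  with w show "\<exists>u\<in>Linf (lebesgue_on {0<..<T}). (\<integral>x. (cmod (control_state T u x - (c * f x + g x)))\<^sup>2 \<partial>lebesgue) < \<epsilon>"
    by (intro bexI[of _ ?w])
qed

lemma approximable_0: assumes "T > 0" shows "approximable T (\<lambda>x. 0)"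
proof -
  have "approximable T (control_state T (\<lambda>x. 0))"
    by (rule approximable_control_state[OF assms]) (auto simp: Linf_def)
  then show ?thesis by (simp add: control_state_def[abs_def])
qed

lemma approximable_sum:
  assumes T: "T > 0" and "finite I" "\<And>i. i \<in> I \<Longrightarrow> approximable T (f i)"
  shows "approximable T (\<lambda>x. \<Sum>i\<in>I. c i * f i x)"
  using assms(2,3)
proof (induction I rule: finite_induct)
  case (insert i I)
  then show ?case using approximable_linear[OF T, of "f i" "\<lambda>x. \<Sum>i\<in>I. c i * f i x" "c i"] by simp
qed (simp add: approximable_0[OF T])

lemma approximable_limit:
  assumes T: "T > 0" and f: "f \<in> L2 lebesgue"
    and h: "\<And>\<epsilon>. \<epsilon> > 0 \<Longrightarrow> \<exists>h. approximable T h \<and> (\<integral>x. (cmod (h x - f x))\<^sup>2 \<partial>lebesgue) < \<epsilon>"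
  shows "approximable T f"
  unfolding approximable_def
proof (intro conjI allI impI f)
  fix \<epsilon> :: real assume "\<epsilon> > 0"
  then have \<epsilon>: "\<epsilon> / 4 > 0" by simp
  obtain h where ah: "approximable T h" and h: "(\<integral>x. (cmod (h x - f x))\<^sup>2 \<partial>lebesgue) < \<epsilon> / 4"
    using h[OF \<epsilon>] by blast
  obtain u where u: "u \<in> Linf (lebesgue_on {0<..<T})"
    and u': "(\<integral>x. (cmod (control_state T u x - h x))\<^sup>2 \<partial>lebesgue) < \<epsilon> / 4"
    using approximableD[OF ah \<epsilon>] by blast
  have "(\<integral>x. (cmod ((control_state T u x - h x) + (h x - f x)))\<^sup>2 \<partial>lebesgue)
    \<le> 2 * (\<integral>x. (cmod (control_state T u x - h x))\<^sup>2 \<partial>lebesgue) + 2 * (\<integral>x. (cmod (h x - f x))\<^sup>2 \<partial>lebesgue)"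
    by (intro integral_cmod_add_sq_le L2_diff control_state_L2 T u f approximable_L2[OF ah])
  then show "\<exists>u\<in>Linf (lebesgue_on {0<..<T}). (\<integral>x. (cmod (control_state T u x - f x))\<^sup>2 \<partial>lebesgue) < \<epsilon>"
    using h u' u by (intro bexI[of _ u]) auto
qed

text \<open>The common tool for every later limit: pulses, polynomials, indicators and simple
  functions. The bound by \<open>w\<close> passes to the limit \<open>f\<close>, so \<open>f\<close>
  is square integrable and 4|w|^2 is a majorant for the squared error.\<close>

lemma approximable_dominated:
  assumes T: "T > 0" and h: "\<And>n. approximable T (h n)"
    and w: "w \<in> L2 lebesgue" and f: "f \<in> borel_measurable lebesgue"
    and lim: "AE x in lebesgue. (\<lambda>n. h n x) \<longlonglongrightarrow> f x"
    and bound: "\<And>n. AE x in lebesgue. cmod (h n x) \<le> cmod (w x)"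
  shows "approximable T f"
proof -
  have "AE x in lebesgue. \<forall>n. cmod (h n x) \<le> cmod (w x)"
    using bound by (simp add: AE_all_countable)
  with lim have fw: "AE x in lebesgue. cmod (f x) \<le> cmod (w x)"
  proof eventually_elim
    case (elim x)
    then show ?case by (intro tendsto_upperbound[OF tendsto_norm[OF elim(1)]]) auto
  qed
  then have fL2: "f \<in> L2 lebesgue"
    by (intro L2_bound[OF f L2_integrable[OF w]]) (auto elim!: eventually_mono intro: power_mono)
  have "(\<lambda>n. \<integral>x. (cmod (h n x - f x))\<^sup>2 \<partial>lebesgue) \<longlonglongrightarrow> (\<integral>x. 0 \<partial>(lebesgue :: (real^2) measure))"
  proof (rule integral_dominated_convergence[where w="\<lambda>x. 4 * (cmod (w x))\<^sup>2"])
    show "(\<lambda>x. (cmod (h n x - f x))\<^sup>2) \<in> borel_measurable lebesgue" for n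
      using L2_measurable[OF approximable_L2[OF h[of n]]] f by simp
    show "integrable lebesgue (\<lambda>x. 4 * (cmod (w x))\<^sup>2)" using L2_integrable[OF w] by simp
    show "AE x in lebesgue. (\<lambda>n. (cmod (h n x - f x))\<^sup>2) \<longlonglongrightarrow> 0"
      using lim
    proof eventually_elim
      case (elim x)
      have "(\<lambda>n. (cmod (h n x - f x))\<^sup>2) \<longlonglongrightarrow> (cmod (f x - f x))\<^sup>2"
        by (intro tendsto_intros elim)
      then show ?case by simp
    qed
    show "AE x in lebesgue. norm ((cmod (h n x - f x))\<^sup>2) \<le> 4 * (cmod (w x))\<^sup>2" for n
      using bound[of n] fw
    proof eventually_elim
      case (elim x)
      have "cmod (h n x - f x) \<le> 2 * cmod (w x)"
        using norm_triangle_ineq4[of "h n x" "f x"] elim by linarith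
      then have "(cmod (h n x - f x))\<^sup>2 \<le> (2 * cmod (w x))\<^sup>2" by (intro power_mono) auto
      then show ?case by (simp add: power_mult_distrib)
    qed
  qed simp
  then have L: "(\<lambda>n. \<integral>x. (cmod (h n x - f x))\<^sup>2 \<partial>lebesgue) \<longlonglongrightarrow> 0" by simp
  show ?thesis
  proof (rule approximable_limit[OF T fL2])
    fix \<epsilon> :: real assume "\<epsilon> > 0"
    then obtain n where "(\<integral>x. (cmod (h n x - f x))\<^sup>2 \<partial>lebesgue) < \<epsilon>"
      using order_tendstoD(2)[OF L] eventually_happens'[OF sequentially_bot] by blast
    then show "\<exists>h. approximable T h \<and> (\<integral>x. (cmod (h x - f x))\<^sup>2 \<partial>lebesgue) < \<epsilon>"
      using h by blast
  qed
qed

section \<open>Gaussians as limits of pulses\<close>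

lemma set_integrable_exp_neg:
  assumes "q > 0"
  shows "set_integrable lborel {0<..} (\<lambda>s::real. exp (- q * s))"
proof -
  have "(\<lambda>s::real. exp (- q * s)) absolutely_integrable_on {0..}"
    using integrable_on_exp_minus_to_infinity[OF assms, of 0]
    by (intro nonnegative_absolutely_integrable_1) simp_all
  then have "(\<lambda>s::real. exp (- q * s)) absolutely_integrable_on {0<..}"
    by (rule set_integrable_subset) auto
  then show ?thesis
    unfolding set_integrable_def by (subst (asm) integrable_completion) auto
qed

lemma gaussian_L2:
  assumes "q > 0"
  shows "(\<lambda>x :: real^2. complex_of_real (exp (- q * (norm x)\<^sup>2))) \<in> L2 lebesgue"
proof (rule L2_radial[where k="\<lambda>s. complex_of_real (exp (- q * s))" and w="\<lambda>s. exp (- (2 * q) * s)"])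
  show "set_integrable lborel {0<..} (\<lambda>s. exp (- (2 * q) * s))"
    using assms by (intro set_integrable_exp_neg) simp
  show "(cmod (complex_of_real (exp (- q * s))))\<^sup>2 \<le> exp (- (2 * q) * s)" for s
    by (simp flip: exp_double)
qed measurable

text \<open>Lipschitz constant 1 of exp(-t) on t \<ge> 0; it turns the width of a pulse into an
  error bound.\<close>

lemma exp_neg_diff_le:
  fixes a b :: real
  assumes "0 \<le> a" "a \<le> b"
  shows "\<bar>exp (- a) - exp (- b)\<bar> \<le> b - a"
proof -
  have "exp (- a) - exp (- b) = exp (- a) * (1 - exp (- (b - a)))"
    by (simp add: right_diff_distrib flip: exp_add)
  also have "\<dots> \<le> 1 * (b - a)"
  proof (rule mult_mono)
    show "1 - exp (- (b - a)) \<le> b - a"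
      using exp_ge_add_one_self[of "- (b - a)"] by linarith
  qed (use assms in auto)
  finally show ?thesis using assms by simp
qed

text \<open>The first bound does not depend on \<delta> and serves as the majorant when pulses
  shrink; the second gives pointwise convergence at each fixed \<open>s\<close>. The profile is the
  mean of exp(-s/(4\<xi>)) over the pulse, hence below the value at \<xi> = T and close to the value
  at \<xi>0.\<close>

lemma pulse_control:
  assumes \<xi>0: "0 < \<xi>0" and \<delta>: "0 < \<delta>" and T: "\<xi>0 + \<delta> < T"
  obtains u where "u \<in> Linf (lebesgue_on {0<..<T})"
    and "\<And>s. s > 0 \<Longrightarrow> cmod (control_profile T u s) \<le> exp (- s / (4 * T))"
    and "\<And>s. s > 0 \<Longrightarrow> cmod (control_profile T u s - of_real (exp (- s / (4 * \<xi>0)))) \<le> s * \<delta> / (4 * \<xi>0\<^sup>2)"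
proof -
  define A where "A = {\<xi>0..\<xi>0 + \<delta>}"
  \<comment> \<open>In the variable \<xi> = T - t the control is -2 pi \<xi>/\<delta> on
    \<open>A\<close>. This cancels both 1/(2\<xi>) and the prefactor -1/pi of the profile, leaving
    the plain average \<open>m\<close> over an interval of length \<delta>.\<close>
  define u where "u = (\<lambda>t. complex_of_real (- pi * (2 * (T - t)) / \<delta> * indicator A (T - t)))"
  have AT: "A \<subseteq> {0<..<T}" using assms by (auto simp: A_def)
  let ?M = "lebesgue_on {0<..<T}"
  interpret finite_measure ?M
    by (intro finite_measure_lebesgue_on) (simp add: lmeasurable_interval)
  have [measurable]: "A \<in> sets borel" by (simp add: A_def)
  have bm: "f \<in> borel_measurable ?M" if "f \<in> borel_measurable borel" for f :: "real \<Rightarrow> 'z::topological_space"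
    using that by (intro measurable_restrict_space1 measurable_completion) auto
  have u: "u \<in> Linf ?M"
  proof -
    have "u \<in> borel_measurable borel" unfolding u_def by measurable
    moreover have "cmod (u t) \<le> pi * (2 * T) / \<delta>" for t
    proof -
      have "cmod (u t) = pi * \<bar>2 * (T - t)\<bar> / \<delta> * indicator A (T - t)"
        unfolding u_def norm_of_real using \<delta> by (simp add: abs_mult)
      also have "\<dots> \<le> pi * (2 * T) / \<delta> * 1"
      proof (cases "T - t \<in> A")
        case True
        then have "\<bar>2 * (T - t)\<bar> \<le> 2 * T" using AT by auto
        then have "pi * \<bar>2 * (T - t)\<bar> / \<delta> \<le> pi * (2 * T) / \<delta>"
          using \<delta> by (intro divide_right_mono mult_left_mono) auto
        then show ?thesis using True by simp
      next
        case False
        then show ?thesis using assms by simp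
      qed
      finally show ?thesis by simp
    qed
    ultimately show ?thesis by (auto simp: Linf_def intro: bm)
  qed
  have intg: "integrable ?M (\<lambda>\<xi>. indicator A \<xi> * exp (- s / (4 * \<xi>)))" if "s > 0" for s :: real
  proof (rule integrable_const_bound[where B=1])
    show "(\<lambda>\<xi>. indicator A \<xi> * exp (- s / (4 * \<xi>))) \<in> borel_measurable ?M"
      by (rule bm) measurable
    show "AE \<xi> in ?M. norm (indicator A \<xi> * exp (- s / (4 * \<xi>))) \<le> 1"
      using that AT by (intro AE_I2) (auto simp: indicator_def)
  qed
  have intA: "integrable ?M (indicator A :: real \<Rightarrow> real)"
    by (rule integrable_const_bound[where B=1]) (auto intro!: bm)
  have mA: "(\<integral>\<xi>. indicator A \<xi> \<partial>?M) = \<delta>"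
  proof -
    have "A \<in> sets lebesgue" by (intro sets_completionI_sets) simp
    then have "(\<integral>\<xi>. indicator A \<xi> \<partial>?M) = measure lebesgue A"
      using AT by (subst Bochner_Integration.integral_indicator) (auto simp: measure_restrict_space Int_absorb2)
    then show ?thesis using \<delta> by (simp add: A_def)
  qed
  define m where "m s = (1 / \<delta>) * (\<integral>\<xi>. indicator A \<xi> * exp (- s / (4 * \<xi>)) \<partial>?M)" for s :: real
  have prof: "control_profile T u s = complex_of_real (m s)" if "s > 0" for s
  proof -
    have "(\<integral>\<xi>. control_integrand T u s \<xi> \<partial>?M)
        = (\<integral>\<xi>. complex_of_real (- pi / \<delta> * (indicator A \<xi> * exp (- s / (4 * \<xi>)))) \<partial>?M)"
      by (rule Bochner_Integration.integral_cong) (auto simp: control_integrand_def u_def indicator_def field_simps)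
    also have "\<dots> = complex_of_real (- pi / \<delta> * (\<integral>\<xi>. indicator A \<xi> * exp (- s / (4 * \<xi>)) \<partial>?M))"
      by (subst integral_complex_of_real) (simp only: integral_mult_right_zero)
    finally show ?thesis by (simp add: control_profile_def m_def)
  qed
  have b1: "\<bar>m s\<bar> \<le> exp (- s / (4 * T))" if s: "s > 0" for s
  proof -
    have "0 \<le> (\<integral>\<xi>. indicator A \<xi> * exp (- s / (4 * \<xi>)) \<partial>?M)"
      by (rule Bochner_Integration.integral_nonneg) auto
    moreover have "(\<integral>\<xi>. indicator A \<xi> * exp (- s / (4 * \<xi>)) \<partial>?M) \<le> (\<integral>\<xi>. indicator A \<xi> * exp (- s / (4 * T)) \<partial>?M)"
    proof (rule integral_mono[OF intg[OF s]])
      show "integrable ?M (\<lambda>\<xi>. indicator A \<xi> * exp (- s / (4 * T)))" using intA by simp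
      show "indicator A \<xi> * exp (- s / (4 * \<xi>)) \<le> indicator A \<xi> * exp (- s / (4 * T))" if "\<xi> \<in> space ?M" for \<xi>
        using that s by (intro mult_left_mono) (auto simp: field_simps)
    qed
    ultimately show ?thesis using \<delta> mA by (simp add: m_def field_simps)
  qed
  have b2: "\<bar>m s - exp (- s / (4 * \<xi>0))\<bar> \<le> s * \<delta> / (4 * \<xi>0\<^sup>2)" if s: "s > 0" for s
  proof -
    have "m s - exp (- s / (4 * \<xi>0)) = (1 / \<delta>) * ((\<integral>\<xi>. indicator A \<xi> * exp (- s / (4 * \<xi>)) \<partial>?M) - (\<integral>\<xi>. indicator A \<xi> * exp (- s / (4 * \<xi>0)) \<partial>?M))"
      using \<delta> mA by (simp add: m_def field_simps)
    also have "\<dots> = (1 / \<delta>) * (\<integral>\<xi>. indicator A \<xi> * (exp (- s / (4 * \<xi>)) - exp (- s / (4 * \<xi>0))) \<partial>?M)"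
      using intg[OF s] intA by (subst Bochner_Integration.integral_diff[symmetric]) (auto simp: algebra_simps)
    finally have e: "m s - exp (- s / (4 * \<xi>0)) = (1 / \<delta>) * (\<integral>\<xi>. indicator A \<xi> * (exp (- s / (4 * \<xi>)) - exp (- s / (4 * \<xi>0))) \<partial>?M)" .
    have "norm (\<integral>\<xi>. indicator A \<xi> * (exp (- s / (4 * \<xi>)) - exp (- s / (4 * \<xi>0))) \<partial>?M)
        \<le> (\<integral>\<xi>. norm (indicator A \<xi> * (exp (- s / (4 * \<xi>)) - exp (- s / (4 * \<xi>0)))) \<partial>?M)"
      by (rule integral_norm_bound)
    also have "\<dots> \<le> (\<integral>\<xi>. indicator A \<xi> * (s * \<delta> / (4 * \<xi>0\<^sup>2)) \<partial>?M)"
    proof (rule integral_mono)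
      show "integrable ?M (\<lambda>\<xi>. norm (indicator A \<xi> * (exp (- s / (4 * \<xi>)) - exp (- s / (4 * \<xi>0)))))"
        using intg[OF s] intA by (intro integrable_norm) (simp add: right_diff_distrib)
      show "integrable ?M (\<lambda>\<xi>. indicator A \<xi> * (s * \<delta> / (4 * \<xi>0\<^sup>2)))" using intA by simp
      fix \<xi> assume "\<xi> \<in> space ?M"
      show "norm (indicator A \<xi> * (exp (- s / (4 * \<xi>)) - exp (- s / (4 * \<xi>0)))) \<le> indicator A \<xi> * (s * \<delta> / (4 * \<xi>0\<^sup>2))"
      proof (cases "\<xi> \<in> A")
        case True
        then have \<xi>: "\<xi>0 \<le> \<xi>" "\<xi> \<le> \<xi>0 + \<delta>" by (auto simp: A_def)
        have "\<bar>exp (- (s / (4 * \<xi>))) - exp (- (s / (4 * \<xi>0)))\<bar> \<le> s / (4 * \<xi>0) - s / (4 * \<xi>)"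
          using \<xi> s \<xi>0 by (intro exp_neg_diff_le) (auto intro!: divide_left_mono)
        also have "\<dots> = s * (\<xi> - \<xi>0) / (4 * (\<xi>0 * \<xi>))"
          using \<xi> \<xi>0 by (simp add: field_simps)
        also have "\<dots> \<le> s * \<delta> / (4 * (\<xi>0 * \<xi>0))"
          using \<xi> \<xi>0 s \<delta> by (intro frac_le mult_left_mono) auto
        finally show ?thesis using True by (simp add: power2_eq_square)
      qed simp
    qed
    also have "\<dots> = \<delta> * (s * \<delta> / (4 * \<xi>0\<^sup>2))" using mA by simp
    finally have "\<bar>\<integral>\<xi>. indicator A \<xi> * (exp (- s / (4 * \<xi>)) - exp (- s / (4 * \<xi>0))) \<partial>?M\<bar> \<le> \<delta> * (s * \<delta> / (4 * \<xi>0\<^sup>2))"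
      by simp
    then have "(1 / \<delta>) * \<bar>\<integral>\<xi>. indicator A \<xi> * (exp (- s / (4 * \<xi>)) - exp (- s / (4 * \<xi>0))) \<partial>?M\<bar> \<le> (1 / \<delta>) * (\<delta> * (s * \<delta> / (4 * \<xi>0\<^sup>2)))"
      using \<delta> by (intro mult_left_mono) auto
    then show ?thesis unfolding e using \<delta> by (simp add: abs_mult)
  qed
  show ?thesis
  proof (rule that[OF u])
    show "cmod (control_profile T u s) \<le> exp (- s / (4 * T))" if "s > 0" for s
      using b1[OF that] prof[OF that] by simp
    show "cmod (control_profile T u s - of_real (exp (- s / (4 * \<xi>0)))) \<le> s * \<delta> / (4 * \<xi>0\<^sup>2)" if "s > 0" for s
      unfolding prof[OF that] of_real_diff[symmetric] norm_of_real by (rule b2[OF that])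
  qed
qed

lemma approximable_gaussian:
  assumes T: "T > 0" and q: "q > 1 / (4 * T)"
  shows "approximable T (\<lambda>x. of_real (exp (- q * (norm x)\<^sup>2)))"
proof -
  \<comment> \<open>The time whose heat factor has exponent \<open>q\<close>; the hypothesis on
    \<open>q\<close> says exactly that it lies before \<open>T\<close>, leaving room for a pulse to
    its right.\<close>
  define \<xi>0 where "\<xi>0 = 1 / (4 * q)"
  have "q > 0" using assms by (smt (verit) zero_less_divide_1_iff)
  then have \<xi>0: "0 < \<xi>0" "\<xi>0 < T" using assms by (auto simp: \<xi>0_def field_simps)
  \<comment> \<open>The denominator starts at 2, so that the pulse fits strictly below
    \<open>T\<close> already for n = 0.\<close>
  define \<delta> where "\<delta> n = (T - \<xi>0) / (real n + 2)" for n
  have \<delta>: "0 < \<delta> n" "\<xi>0 + \<delta> n < T" for n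
  proof -
    show "0 < \<delta> n" using \<xi>0 by (simp add: \<delta>_def)
    have "(T - \<xi>0) * 1 < (T - \<xi>0) * (real n + 2)" using \<xi>0 by (intro mult_strict_left_mono) auto
    then have "\<delta> n < T - \<xi>0" unfolding \<delta>_def by (subst pos_divide_less_eq) auto
    then show "\<xi>0 + \<delta> n < T" by simp
  qed
  have \<delta>0: "\<delta> \<longlonglongrightarrow> 0" unfolding \<delta>_def by real_asymp
  have "\<exists>u. u \<in> Linf (lebesgue_on {0<..<T}) \<and> (\<forall>s>0. cmod (control_profile T u s) \<le> exp (- s / (4 * T)))
     \<and> (\<forall>s>0. cmod (control_profile T u s - of_real (exp (- s / (4 * \<xi>0)))) \<le> s * \<delta> n / (4 * \<xi>0\<^sup>2))" for n
    using pulse_control[OF \<xi>0(1) \<delta>[of n]] by metis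
  then obtain u where u: "\<And>n. u n \<in> Linf (lebesgue_on {0<..<T})"
    and u1: "\<And>n s. s > 0 \<Longrightarrow> cmod (control_profile T (u n) s) \<le> exp (- s / (4 * T))"
    and u2: "\<And>n s. s > 0 \<Longrightarrow> cmod (control_profile T (u n) s - of_real (exp (- s / (4 * \<xi>0)))) \<le> s * \<delta> n / (4 * \<xi>0\<^sup>2)"
    by metis
  have AE0: "AE x :: real^2 in lebesgue. x \<noteq> 0"
    by (rule AE_completion) (rule AE_lborel_singleton)
  show ?thesis
  proof (rule approximable_dominated[OF T, where h="\<lambda>n. control_state T (u n)"])
    show "approximable T (control_state T (u n))" for n
      by (rule approximable_control_state[OF T u])
    show "(\<lambda>x :: real^2. complex_of_real (exp (- (1 / (4 * T)) * (norm x)\<^sup>2))) \<in> L2 lebesgue"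
      using T by (intro gaussian_L2) simp
    show "(\<lambda>x :: real^2. complex_of_real (exp (- q * (norm x)\<^sup>2))) \<in> borel_measurable lebesgue"
      by (rule L2_measurable[OF gaussian_L2[OF \<open>q > 0\<close>]])
    show "AE x in lebesgue. cmod (control_state T (u n) x) \<le> cmod (complex_of_real (exp (- (1 / (4 * T)) * (norm x)\<^sup>2)))" for n
      using AE0
    proof eventually_elim
      case (elim x)
      then show ?case using u1[of "(norm x)\<^sup>2" n] by (simp add: control_state_eq_profile)
    qed
    show "AE x in lebesgue. (\<lambda>n. control_state T (u n) x) \<longlonglongrightarrow> complex_of_real (exp (- q * (norm x)\<^sup>2))"
      using AE0
    proof eventually_elim
      case (elim x)
      define s where "s = (norm x)\<^sup>2"
      have s: "s > 0" using elim by (simp add: s_def)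
      have "(\<lambda>n. s * \<delta> n / (4 * \<xi>0\<^sup>2)) \<longlonglongrightarrow> s * 0 / (4 * \<xi>0\<^sup>2)"
        using \<xi>0 by (intro tendsto_intros \<delta>0) auto
      then have lim: "(\<lambda>n. s * \<delta> n / (4 * \<xi>0\<^sup>2)) \<longlonglongrightarrow> 0" by simp
      have "(\<lambda>n. control_profile T (u n) s - of_real (exp (- s / (4 * \<xi>0)))) \<longlonglongrightarrow> 0"
        by (rule Lim_null_comparison[OF always_eventually lim]) (rule allI, rule u2[OF s])
      moreover have "- s / (4 * \<xi>0) = - q * s" using \<open>q > 0\<close> by (simp add: \<xi>0_def)
      ultimately show ?case
        by (simp add: control_state_eq_profile s_def[symmetric] LIM_zero_iff)
    qed
  qed
qed

section \<open>Density in the radial functions\<close>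

text \<open>The monomial y^i raises the exponent from q to q + i, which stays above the threshold
  1/(4T), so each term is again an available Gaussian.\<close>

lemma approximable_gaussian_polynomial:
  assumes T: "T > 0" and q: "q > 1 / (4 * T)" and p: "real_polynomial_function p"
  shows "approximable T (\<lambda>x. of_real (exp (- q * (norm x)\<^sup>2) * p (exp (- (norm x)\<^sup>2))))"
proof -
  obtain a n where p: "p = (\<lambda>y. \<Sum>i\<le>n. a i * y ^ i)"
    using p real_polynomial_function_imp_sum by blast
  have "approximable T (\<lambda>x. \<Sum>i\<in>{..n}. of_real (a i) * of_real (exp (- (q + real i) * (norm x)\<^sup>2)))"
    using q by (intro approximable_sum T approximable_gaussian) auto
  also have "(\<lambda>x :: real^2. \<Sum>i\<in>{..n}. complex_of_real (a i) * of_real (exp (- (q + real i) * (norm x)\<^sup>2)))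
      = (\<lambda>x. of_real (exp (- q * (norm x)\<^sup>2) * p (exp (- (norm x)\<^sup>2))))"
  proof
    fix x :: "real^2"
    have "exp (- q * s) * (a i * exp (- s) ^ i) = a i * exp (- (q + real i) * s)" for i and s :: real
    proof -
      have "- (q + real i) * s = - q * s + real i * - s" by (simp add: algebra_simps)
      then have "exp (- (q + real i) * s) = exp (- q * s) * exp (- s) ^ i"
        by (simp only: exp_add exp_of_nat_mult)
      then show ?thesis by (simp only: mult.left_commute)
    qed
    then show "(\<Sum>i\<in>{..n}. complex_of_real (a i) * of_real (exp (- (q + real i) * (norm x)\<^sup>2)))
        = of_real (exp (- q * (norm x)\<^sup>2) * p (exp (- (norm x)\<^sup>2)))"
      unfolding p sum_distrib_left by (simp only: of_real_sum of_real_mult)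
  qed
  finally show ?thesis .
qed

lemma weighted_measurable:
  fixes H :: "real \<Rightarrow> real"
  assumes [measurable]: "H \<in> borel_measurable borel"
  shows "(\<lambda>x :: real^2. complex_of_real (exp (- q * (norm x)\<^sup>2) * H (exp (- (norm x)\<^sup>2)))) \<in> borel_measurable lebesgue"
  by (intro measurable_completion) measurable

lemma scaled_gaussian_L2:
  assumes "q > 0"
  shows "(\<lambda>x :: real^2. complex_of_real (c * exp (- q * (norm x)\<^sup>2))) \<in> L2 lebesgue"
  using L2_cmult[OF gaussian_L2[OF assms], of "of_real c"] by simp

text \<open>Since y = exp(-|x|^2) lies in [0,1], convergence and boundedness are only asked there. A
  multiple of the Gaussian weight is the L2 majorant, so no uniformity of the convergence is
  involved; this is what lets the Dynkin argument pass to discontinuous \<open>H\<close>.\<close>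

lemma approximable_weighted_limit:
  assumes T: "T > 0" and q: "q > 1 / (4 * T)" and [measurable]: "H \<in> borel_measurable borel"
    and h: "\<And>n. approximable T (\<lambda>x. of_real (exp (- q * (norm x)\<^sup>2) * h n (exp (- (norm x)\<^sup>2))))"
    and lim: "\<And>y. y \<in> {0..1} \<Longrightarrow> (\<lambda>n. h n y) \<longlonglongrightarrow> H y"
    and bound: "\<And>n y. y \<in> {0..1} \<Longrightarrow> \<bar>h n y\<bar> \<le> (B :: real)"
  shows "approximable T (\<lambda>x. of_real (exp (- q * (norm x)\<^sup>2) * H (exp (- (norm x)\<^sup>2))))"
proof (rule approximable_dominated[OF T h scaled_gaussian_L2 weighted_measurable])
  show "q > 0" using T q by (smt (verit) zero_less_divide_1_iff)
  have y: "exp (- (norm x)\<^sup>2) \<in> {0..1}" for x :: "real^2" by simp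
  show "AE x :: real^2 in lebesgue. (\<lambda>n. complex_of_real (exp (- q * (norm x)\<^sup>2) * h n (exp (- (norm x)\<^sup>2))))
      \<longlonglongrightarrow> of_real (exp (- q * (norm x)\<^sup>2) * H (exp (- (norm x)\<^sup>2)))"
    by (intro AE_I2 tendsto_of_real tendsto_mult_left lim y)
  show "AE x :: real^2 in lebesgue. cmod (of_real (exp (- q * (norm x)\<^sup>2) * h n (exp (- (norm x)\<^sup>2))))
      \<le> cmod (complex_of_real (\<bar>B\<bar> * exp (- q * (norm x)\<^sup>2)))" for n
  proof (rule AE_I2)
    fix x :: "real^2"
    have "\<bar>h n (exp (- (norm x)\<^sup>2))\<bar> \<le> \<bar>B\<bar>" using bound[OF y, of n x] by linarith
    then have "exp (- q * (norm x)\<^sup>2) * \<bar>h n (exp (- (norm x)\<^sup>2))\<bar> \<le> exp (- q * (norm x)\<^sup>2) * \<bar>B\<bar>"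
      by (intro mult_left_mono) auto
    then show "cmod (of_real (exp (- q * (norm x)\<^sup>2) * h n (exp (- (norm x)\<^sup>2))))
      \<le> cmod (complex_of_real (\<bar>B\<bar> * exp (- q * (norm x)\<^sup>2)))"
      unfolding norm_of_real abs_mult by (simp add: mult.commute)
  qed
qed measurable

lemma approximable_weighted_continuous:
  assumes T: "T > 0" and q: "q > 1 / (4 * T)"
    and H: "continuous_on UNIV H" "\<And>y. \<bar>H y :: real\<bar> \<le> 1"
  shows "approximable T (\<lambda>x. of_real (exp (- q * (norm x)\<^sup>2) * H (exp (- (norm x)\<^sup>2))))"
proof -
  have "\<exists>p. real_polynomial_function p \<and> (\<forall>y\<in>{0..1}. \<bar>H y - p y\<bar> < 1 / (real n + 1))" for n
  proof (rule Stone_Weierstrass_real_polynomial_function)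
    show "continuous_on {0..1} H" using H(1) by (rule continuous_on_subset) simp
    show "0 < 1 / (real n + 1)" by (simp add: add_nonneg_pos)
  qed auto
  then obtain p where p: "\<And>n. real_polynomial_function (p n)"
    and p': "\<And>n y. y \<in> {0..1} \<Longrightarrow> \<bar>H y - p n y\<bar> < 1 / (real n + 1)"
    by metis
  show ?thesis
  \<comment> \<open>The bound 2 is the bound 1 on \<open>H\<close> plus a polynomial error of at
    most 1.\<close>
  proof (rule approximable_weighted_limit[OF T q borel_measurable_continuous_onI[OF H(1)], where h=p and B=2])
    show "approximable T (\<lambda>x. of_real (exp (- q * (norm x)\<^sup>2) * p n (exp (- (norm x)\<^sup>2))))" for n
      by (rule approximable_gaussian_polynomial[OF T q p])
    fix y :: real assume y: "y \<in> {0..1}"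
    have z: "(\<lambda>n. 1 / (real n + 1)) \<longlonglongrightarrow> 0" by real_asymp
    have "norm (p n y - H y) \<le> 1 / (real n + 1)" for n
      using p'[OF y, of n] by simp
    then have "(\<lambda>n. p n y - H y) \<longlonglongrightarrow> 0"
      by (intro Lim_null_comparison[OF always_eventually z] allI)
    then show "(\<lambda>n. p n y) \<longlonglongrightarrow> H y" by (rule LIM_zero_cancel)
    show "\<bar>p n y\<bar> \<le> 2" for n
    proof -
      have "1 / (real n + 1) \<le> 1" by simp
      then show ?thesis using p'[OF y, of n] H(2)[of y] by linarith
    qed
  qed
qed

lemma approximable_weighted_indicator:
  assumes T: "T > 0" and q: "q > 1 / (4 * T)" and A: "A \<in> sets borel"
  shows "approximable T (\<lambda>x. of_real (exp (- q * (norm x)\<^sup>2) * indicator A (exp (- (norm x)\<^sup>2))))"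
    (is "?P A")
proof -
  have "Int_stable (range (atMost :: real \<Rightarrow> real set))"
    by (auto simp: Int_stable_def min_def[symmetric])
  moreover have "range (atMost :: real \<Rightarrow> real set) \<subseteq> Pow UNIV" by simp
  moreover have "A \<in> sigma_sets UNIV (range atMost)"
    using A by (simp add: borel_eq_atMost)
  ultimately show ?thesis
  proof (induction rule: sigma_sets_induct_disjoint)
    case (basic A)
    then obtain a where A: "A = {..a}" by auto
    \<comment> \<open>For n > 0 a continuous ramp: 1 up to \<open>a\<close>, then linear down to 0
      at a + 1/n. It converges pointwise to the indicator of the closed half-line, including at
      \<open>a\<close> itself.\<close>
    define h where "h n y = max 0 (min 1 (1 - real n * (y - a)))" for n and y :: real
    show ?case unfolding A
    proof (rule approximable_weighted_limit[OF T q, where h=h and B=1])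
      show "approximable T (\<lambda>x. of_real (exp (- q * (norm x)\<^sup>2) * h n (exp (- (norm x)\<^sup>2))))" for n
        by (rule approximable_weighted_continuous[OF T q])
          (auto simp: h_def intro!: continuous_intros)
      show "\<bar>h n y\<bar> \<le> 1" for n y by (auto simp: h_def)
      show "(\<lambda>n. h n y) \<longlonglongrightarrow> indicator {..a} y" for y
      proof (cases "y \<le> a")
        case True
        then have "h n y = 1" for n
          using mult_nonneg_nonpos[of "real n" "y - a"] by (simp add: h_def)
        then show ?thesis using True by simp
      next
        case False
        then obtain N where N: "1 < real N * (y - a)"
          using reals_Archimedean3[of "y - a"] by auto
        have "h n y = 0" if "n \<ge> N" for n
        proof -
          have "real N * (y - a) \<le> real n * (y - a)" using that False by (intro mult_right_mono) auto
          then show ?thesis using N by (simp add: h_def)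
        qed
        then have "\<forall>\<^sub>F n in sequentially. h n y = 0"
          by (auto simp: eventually_sequentially)
        then show ?thesis using False by (simp add: tendsto_eventually)
      qed
    qed measurable
  next
    case empty
    then show ?case using approximable_0[OF T] by simp
  next
    case (compl A)
    \<comment> \<open>The indicator of the whole line corresponds to the bare Gaussian, so the
      complement is a difference of two approximable functions.\<close>
    have "(\<lambda>x :: real^2. complex_of_real (exp (- q * (norm x)\<^sup>2) * indicator (UNIV - A) (exp (- (norm x)\<^sup>2))))
      = (\<lambda>x. (- 1) * of_real (exp (- q * (norm x)\<^sup>2) * indicator A (exp (- (norm x)\<^sup>2))) + of_real (exp (- q * (norm x)\<^sup>2)))"
      by (auto simp: indicator_def)
    then show ?case
      using approximable_linear[OF T compl(2) approximable_gaussian[OF T q], of "- 1"] by simp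
  next
    case (union A)
    have Am: "A i \<in> sets borel" for i
      using union(2) by (auto simp: borel_eq_atMost)
    show ?case
    proof (rule approximable_weighted_limit[OF T q, where h="\<lambda>n y. \<Sum>i<n. indicator (A i) y" and B=1])
      show "(indicator (\<Union>i. A i) :: real \<Rightarrow> real) \<in> borel_measurable borel"
        using Am by (intro borel_measurable_indicator) auto
      fix n
      have "approximable T (\<lambda>x. \<Sum>i\<in>{..<n}. 1 * of_real (exp (- q * (norm x)\<^sup>2) * indicator (A i) (exp (- (norm x)\<^sup>2))))"
        by (intro approximable_sum T union) auto
      then show "approximable T (\<lambda>x. of_real (exp (- q * (norm x)\<^sup>2) * (\<Sum>i<n. indicator (A i) (exp (- (norm x)\<^sup>2)))))"
        by (simp only: sum_distrib_left of_real_sum mult_1_left)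
    next
      show "(\<lambda>n. \<Sum>i<n. indicator (A i) y) \<longlonglongrightarrow> (indicator (\<Union>i. A i) y :: real)" for y
        using indicator_sums[of A y] union(1) by (auto simp: sums_def disjoint_family_on_def)
      \<comment> \<open>Disjointness makes each partial sum an indicator again, hence bounded by 1
        uniformly in \<open>n\<close>.\<close>
      have "(\<Sum>i<n. indicator (A i) y) = (indicator (\<Union>i<n. A i) y :: real)" for n y
        using union(1) by (intro indicator_UN_disjoint[symmetric]) (auto simp: disjoint_family_on_def)
      then show "\<bar>\<Sum>i<n. indicator (A i) y\<bar> \<le> (1 :: real)" for n y
        by (simp add: indicator_def)
    qed
  qed
qed

text \<open>Simple functions approximate the target after division by the Gaussian weight. Each of
  their levels is a weighted indicator, and approximation with at most twice the modulus becomes,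
  after multiplying back, domination by 2|k|, which is in L2 although the quotient itself may not
  even be bounded.\<close>

lemma approximable_radial_borel:
  assumes T: "T > 0" and k[measurable]: "k \<in> borel_measurable borel"
    and L2: "(\<lambda>x :: real^2. k ((norm x)\<^sup>2)) \<in> L2 lebesgue"
  shows "approximable T (\<lambda>x. k ((norm x)\<^sup>2))"
proof -
  define q where "q = 1 / (4 * T) + 1"
  have q: "q > 1 / (4 * T)" by (simp add: q_def)
  \<comment> \<open>The quotient of \<open>k\<close> by the weight exp(-q s), written in y =
    exp(-s), so that s = -ln y and exp(q s) = y^(-q).\<close>
  define F where "F y = k (- ln y) * of_real (y powr (- q))" for y :: real
  have "F \<in> borel_measurable borel" unfolding F_def by measurable
  then obtain G where G: "\<And>i. simple_function borel (G i)" "\<And>y. (\<lambda>i. G i y) \<longlonglongrightarrow> F y"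
      "\<And>i y. dist (G i y) 0 \<le> 2 * dist (F y) 0"
    using borel_measurable_implies_sequence_metric[of F borel 0] by auto
  have FG: "of_real (exp (- q * s)) * F (exp (- s)) = k s" for s
  proof -
    have "exp (- s) powr (- q) = exp (q * s)" by (simp add: powr_def)
    then have "of_real (exp (- q * s)) * F (exp (- s)) = k s * of_real (exp (- q * s) * exp (q * s))"
      by (simp add: F_def mult_ac)
    also have "exp (- q * s) * exp (q * s) = 1" by (simp flip: exp_add)
    finally show ?thesis by simp
  qed
  show ?thesis
  proof (rule approximable_dominated[OF T, where h="\<lambda>i x. of_real (exp (- q * (norm x)\<^sup>2)) * G i (exp (- (norm x)\<^sup>2))"
      and w="\<lambda>x. 2 * k ((norm x)\<^sup>2)"])
    show "approximable T (\<lambda>x. of_real (exp (- q * (norm x)\<^sup>2)) * G i (exp (- (norm x)\<^sup>2)))" for i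
    proof -
      have fin: "finite (range (G i))" and m: "G i -` {v} \<in> sets borel" for v
        using G(1)[of i] simple_functionD[OF G(1)[of i]] by auto
      have "approximable T (\<lambda>x. \<Sum>v\<in>range (G i). v * of_real (exp (- q * (norm x)\<^sup>2) * indicator (G i -` {v}) (exp (- (norm x)\<^sup>2))))"
        by (intro approximable_sum T fin approximable_weighted_indicator q m)
      also have "(\<lambda>x :: real^2. \<Sum>v\<in>range (G i). v * of_real (exp (- q * (norm x)\<^sup>2) * indicator (G i -` {v}) (exp (- (norm x)\<^sup>2))))
        = (\<lambda>x. of_real (exp (- q * (norm x)\<^sup>2)) * G i (exp (- (norm x)\<^sup>2)))"
      proof
        fix x :: "real^2"
        define y where "y = exp (- (norm x)\<^sup>2)"
        have "G i y = (\<Sum>v\<in>range (G i). indicator (G i -` {v}) y *\<^sub>R v)"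
          using simple_function_indicator_representation_banach[OF G(1)[of i], of y]
          by (simp only: space_borel Int_UNIV_right UNIV_I)
        then have "of_real (exp (- q * (norm x)\<^sup>2)) * G i y
            = of_real (exp (- q * (norm x)\<^sup>2)) * (\<Sum>v\<in>range (G i). indicator (G i -` {v}) y *\<^sub>R v)"
          by (rule arg_cong)
        also have "\<dots> = (\<Sum>v\<in>range (G i). v * of_real (exp (- q * (norm x)\<^sup>2) * indicator (G i -` {v}) y))"
          by (simp add: scaleR_conv_of_real sum_distrib_left mult_ac)
        finally show "(\<Sum>v\<in>range (G i). v * of_real (exp (- q * (norm x)\<^sup>2) * indicator (G i -` {v}) (exp (- (norm x)\<^sup>2))))
          = of_real (exp (- q * (norm x)\<^sup>2)) * G i (exp (- (norm x)\<^sup>2))"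
          unfolding y_def by (rule sym)
      qed
      finally show ?thesis .
    qed
    show "(\<lambda>x :: real^2. 2 * k ((norm x)\<^sup>2)) \<in> L2 lebesgue" by (rule L2_cmult[OF L2])
    show "(\<lambda>x :: real^2. k ((norm x)\<^sup>2)) \<in> borel_measurable lebesgue" by (rule L2_measurable[OF L2])
    show "AE x :: real^2 in lebesgue. (\<lambda>i. of_real (exp (- q * (norm x)\<^sup>2)) * G i (exp (- (norm x)\<^sup>2))) \<longlonglongrightarrow> k ((norm x)\<^sup>2)"
      unfolding FG[symmetric] by (intro AE_I2 tendsto_mult_left G(2))
    show "AE x :: real^2 in lebesgue. cmod (of_real (exp (- q * (norm x)\<^sup>2)) * G i (exp (- (norm x)\<^sup>2))) \<le> cmod (2 * k ((norm x)\<^sup>2))" for i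
    proof (rule AE_I2)
      fix x :: "real^2"
      let ?e = "exp (- q * (norm x)\<^sup>2)" and ?y = "exp (- (norm x)\<^sup>2)"
      have "cmod (of_real ?e * G i ?y) = ?e * cmod (G i ?y)" by (simp only: norm_mult norm_of_real abs_exp_cancel)
      also have "\<dots> \<le> ?e * (2 * cmod (F ?y))" using G(3)[of i ?y] by (intro mult_left_mono) auto
      also have "\<dots> = 2 * cmod (of_real ?e * F ?y)" by (simp only: norm_mult norm_of_real abs_exp_cancel)
      also have "\<dots> = cmod (2 * k ((norm x)\<^sup>2))" unfolding FG by (simp add: norm_mult)
      finally show "cmod (of_real ?e * G i ?y) \<le> cmod (2 * k ((norm x)\<^sup>2))" .
    qed
  qed
qed

text \<open>Membership in \<open>H_radial\<close> provides a Lebesgue measurable function on the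
  half-line, while the image measure under |x|^2 and the substitution s = -ln y are handled for
  Borel functions.\<close>

lemma borel_representative:
  fixes g :: "real \<Rightarrow> complex"
  assumes "g \<in> borel_measurable (lebesgue_on {0<..})"
  obtains k where "k \<in> borel_measurable borel" "AE s in lborel. s > 0 \<longrightarrow> g s = k s"
proof -
  have S: "{0::real<..} \<in> sets lebesgue" by (intro sets_completionI_sets) simp
  define g' where "g' s = (if s \<in> {0<..} then g s else 0)" for s
  have [measurable]: "g' \<in> borel_measurable lebesgue"
    unfolding g'_def using assms by (subst borel_measurable_if[OF S])
  have "(\<lambda>s. Re (g' s)) \<in> borel_measurable lebesgue" "(\<lambda>s. Im (g' s)) \<in> borel_measurable lebesgue"
    by measurable
  then obtain r i where r: "r \<in> borel_measurable lborel" "AE s in lborel. Re (g' s) = r s"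
    and i: "i \<in> borel_measurable lborel" "AE s in lborel. Im (g' s) = i s"
    using completion_ex_borel_measurable_real by metis
  show ?thesis
  proof (rule that)
    show "(\<lambda>s. Complex (r s) (i s)) \<in> borel_measurable borel"
      using r(1) i(1) by (auto simp: borel_measurable_complex_iff)
    show "AE s in lborel. s > 0 \<longrightarrow> g s = Complex (r s) (i s)"
      using r(2) i(2) by eventually_elim (auto simp: g'_def complex_eq_iff)
  qed
qed

lemma approximable_H_radial:
  assumes T: "T > 0" and f: "f \<in> H_radial"
  shows "approximable T f"
proof -
  obtain g where fL2: "f \<in> L2 lebesgue" and g: "g \<in> L2 (lebesgue_on {0<..})"
    and fg: "AE x in lebesgue. f x = g ((norm x)\<^sup>2)"
    using f by (auto simp: H_radial_def)
  obtain k where k: "k \<in> borel_measurable borel" and gk: "AE s in lborel. s > 0 \<longrightarrow> g s = k s"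
    using borel_representative[OF L2_measurable[OF g]] by blast
  have fk: "AE x in lebesgue. k ((norm x)\<^sup>2) = f x"
    using AE_radial[OF gk] fg by eventually_elim simp
  have kL2: "(\<lambda>x :: real^2. k ((norm x)\<^sup>2)) \<in> L2 lebesgue"
    by (rule L2_cong_AE[OF fL2 fk])
  \<comment> \<open>Dominated convergence for a constant sequence: it replaces the Borel
    representative by \<open>f\<close>, which agrees with it almost everywhere.\<close>
  show ?thesis
    by (rule approximable_dominated[OF T approximable_radial_borel[OF T k kL2] kL2 L2_measurable[OF fL2]])
      (use fk in \<open>auto elim!: eventually_mono\<close>)
qed

section \<open>Approximate controllability\<close>

lemma H_radial_limit:
  assumes T: "T > 0" and f: "f \<in> L2 lebesgue" and u: "\<And>n. u n \<in> Linf (lebesgue_on {0<..<T})"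
    and lim: "(\<lambda>n. \<integral>x. (cmod (control_state T (u n) x - f x))\<^sup>2 \<partial>lebesgue) \<longlonglongrightarrow> 0"
  shows "f \<in> H_radial"
proof -
  have "\<exists>r. strict_mono r \<and> (AE x in lebesgue. (\<lambda>n. (cmod (control_state T (u (r n)) x - f x))\<^sup>2) \<longlonglongrightarrow> 0)"
  proof (rule tendsto_L1_AE_subseq)
    show "integrable lebesgue (\<lambda>x. (cmod (control_state T (u n) x - f x))\<^sup>2)" for n
      by (intro L2_integrable L2_diff control_state_L2 T u f)
  qed (use lim in simp)
  then obtain r where r: "AE x in lebesgue. (\<lambda>n. (cmod (control_state T (u (r n)) x - f x))\<^sup>2) \<longlonglongrightarrow> 0"
    by blast
  \<comment> \<open>\<open>lim\<close> is total, so \<open>g\<close> is Borel measurable even where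
    the profiles diverge. For almost every x they converge at |x|^2, and the value there is
    \<open>f x\<close>.\<close>
  define g where "g s = lim (\<lambda>n. control_profile T (u (r n)) s)" for s
  have gm: "g \<in> borel_measurable borel"
    unfolding g_def by (intro borel_measurable_lim_metric control_profile_measurable u)
  have fg: "AE x in lebesgue. f x = g ((norm x)\<^sup>2)"
    using r
  proof eventually_elim
    case (elim x)
    then have "(\<lambda>n. control_state T (u (r n)) x - f x) \<longlonglongrightarrow> 0"
      by (simp add: tendsto_norm_zero_iff)
    then have "(\<lambda>n. control_state T (u (r n)) x) \<longlonglongrightarrow> f x" by (rule LIM_zero_cancel)
    then show ?case unfolding control_state_eq_profile g_def by (rule limI[symmetric])
  qed
  have "(\<lambda>x :: real^2. g ((norm x)\<^sup>2)) \<in> L2 lebesgue"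
    by (rule L2_cong_AE[OF f]) (use fg in \<open>auto elim!: eventually_mono\<close>)
  then have "integrable lebesgue (\<lambda>x :: real^2. (cmod (g ((norm x)\<^sup>2)))\<^sup>2)"
    by (rule L2_integrable)
  then have "set_integrable lborel {0<..} (\<lambda>s. (cmod (g s))\<^sup>2)"
    by (subst (asm) integrable_radial_iff[where k="\<lambda>s. (cmod (g s))\<^sup>2"]) (use gm in auto)
  then have "integrable lebesgue (\<lambda>s. indicator {0<..} s *\<^sub>R (cmod (g s))\<^sup>2)"
    unfolding set_integrable_def by (subst integrable_completion) (use gm in auto)
  then have "integrable (lebesgue_on {0<..}) (\<lambda>s. (cmod (g s))\<^sup>2)"
    by (subst integrable_restrict_space) auto
  moreover have "g \<in> borel_measurable (lebesgue_on {0<..})"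
    by (intro measurable_restrict_space1 measurable_completion) (use gm in simp)
  ultimately have "g \<in> L2 (lebesgue_on {0<..})" by (simp add: L2_def)
  then show ?thesis using f fg by (auto simp: H_radial_def)
qed

section \<open>Evenness of radial functions\<close>

lemma norm_reflect1: "norm (reflect1 x) = norm x"
  by (simp add: reflect1_def norm_vec_def L2_set_def sum_2)

text \<open>Linear maps of the plane send negligible sets to negligible sets, and for an involution
  the image of the exceptional set is its preimage.\<close>

lemma AE_reflect1:
  assumes "AE x in lebesgue. P x"
  shows "AE x in lebesgue. P (reflect1 x)"
proof -
  have lin: "linear reflect1"
    by (rule linearI) (auto simp: reflect1_def vec_eq_iff)
  have inv: "reflect1 (reflect1 x) = x" for x by (simp add: reflect1_def vec_eq_iff)
  have "negligible {x. \<not> P x}"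
    using assms by (simp add: completion.AE_iff_null_sets negligible_iff_null_sets)
  then have "negligible (reflect1 ` {x. \<not> P x})"
    by (rule negligible_differentiable_image_negligible[rotated])
      (auto intro: linear_imp_differentiable_on lin)
  also have "reflect1 ` {x. \<not> P x} = {x. \<not> P (reflect1 x)}"
    using inv by (auto simp: image_iff) metis
  finally show ?thesis
    by (simp add: completion.AE_iff_null_sets negligible_iff_null_sets)
qed

lemma H_radial_even:
  assumes "f \<in> H_radial"
  shows "AE x in lebesgue. f (reflect1 x) = f x"
proof -
  obtain g where fg: "AE x in lebesgue. f x = g ((norm x)\<^sup>2)"
    using assms by (auto simp: H_radial_def)
  show ?thesis
    using fg AE_reflect1[OF fg] by eventually_elim (simp add: norm_reflect1)
qed

theorem theorem3p14:
  fixes T :: real and W0 WT :: "real^2 \<Rightarrow> complex"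
  assumes "T > 0" and "W0 \<in> H0_hat" and "WT \<in> H0_hat"
  shows "approx_controllable T W0 WT \<longleftrightarrow>
    (\<lambda>x. WT x - fun_conv (heat_kernel T) W0 x) \<in> H_radial"
proof -
  note T = assms(1)
  define F where "F = fun_conv (heat_kernel T) W0"
  have WT: "WT \<in> L2 lebesgue" and WTe: "AE x in lebesgue. WT (reflect1 x) = WT x"
    using assms(3) by (auto simp: H0_hat_def)
  let ?f = "\<lambda>x. WT x - F x"
  have "?f \<in> H_radial" if ac: "approx_controllable T W0 WT"
  proof -
    \<comment> \<open>State and control are bundled so that one choice over \<open>n\<close> selects
      both sequences together.\<close>
    define Q where "Q n V u \<longleftrightarrow> V \<in> H0_hat \<and> u \<in> Linf (lebesgue_on {0<..<T}) \<and>
        (AE x in lebesgue. V x = F x + control_state T u x) \<and> L2norm lebesgue (\<lambda>x. V x - WT x) < 1 / (real n + 1)" for n V u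
    have "\<exists>V u. Q n V u" for n
    proof -
      have "\<forall>\<epsilon>>0. \<exists>V\<in>reachable T W0. L2norm lebesgue (\<lambda>x. V x - WT x) < \<epsilon>"
        using ac by (simp add: approx_controllable_def H0_closure_def)
      moreover have "1 / (real n + 1) > 0" by (simp add: add_nonneg_pos)
      ultimately obtain V where V: "V \<in> reachable T W0" "L2norm lebesgue (\<lambda>x. V x - WT x) < 1 / (real n + 1)"
        by blast
      then obtain u where "V \<in> H0_hat" "u \<in> Linf (lebesgue_on {0<..<T})"
        "AE x in lebesgue. V x = F x + control_state T u x"
        by (auto simp: reachable_def free_state_def F_def)
      with V(2) show ?thesis unfolding Q_def by (intro exI[of _ V] exI[of _ u] conjI)
    qed
    then obtain V u where "\<And>n. Q n (V n) (u n)" by metis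
    then have V: "\<And>n. V n \<in> H0_hat" and u: "\<And>n. u n \<in> Linf (lebesgue_on {0<..<T})"
      and Vu: "\<And>n. AE x in lebesgue. V n x = F x + control_state T (u n) x"
      and Vn: "\<And>n. L2norm lebesgue (\<lambda>x. V n x - WT x) < 1 / (real n + 1)"
      by (simp_all add: Q_def)
    have VL2: "V n \<in> L2 lebesgue" for n using V[of n] by (simp add: H0_hat_def)
    have fL2: "?f \<in> L2 lebesgue"
    proof (rule L2_cong_AE)
      show "(\<lambda>x. (WT x - V 0 x) + control_state T (u 0) x) \<in> L2 lebesgue"
        by (intro L2_add L2_diff WT VL2 control_state_L2 T u)
      show "AE x :: real^2 in lebesgue. ?f x = (WT x - V 0 x) + control_state T (u 0) x"
        using Vu[of 0] by eventually_elim simp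
    qed
    show ?thesis
    proof (rule H_radial_limit[OF T fL2 u])
      \<comment> \<open>The free state cancels: the controlled part misses \<open>?f\<close> by
        exactly as much as \<open>V n\<close> misses \<open>WT\<close>.\<close>
      have eq: "(\<integral>x. (cmod (control_state T (u n) x - ?f x))\<^sup>2 \<partial>lebesgue) = (\<integral>x. (cmod (V n x - WT x))\<^sup>2 \<partial>lebesgue)" for n
      proof (rule integral_cong_AE)
        show "AE x :: real^2 in lebesgue. (cmod (control_state T (u n) x - ?f x))\<^sup>2 = (cmod (V n x - WT x))\<^sup>2"
          using Vu[of n] by eventually_elim (simp add: algebra_simps)
      qed (intro borel_measurable_integrable L2_integrable L2_diff control_state_L2 T u fL2 VL2 WT)+
      have z: "(\<lambda>n. (1 / (real n + 1))\<^sup>2) \<longlonglongrightarrow> 0" by real_asymp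
      have "norm (\<integral>x. (cmod (control_state T (u n) x - ?f x))\<^sup>2 \<partial>lebesgue) \<le> (1 / (real n + 1))\<^sup>2" for n
      proof -
        let ?I = "\<integral>x. (cmod (V n x - WT x))\<^sup>2 \<partial>lebesgue"
        have "?I \<ge> 0" by (rule Bochner_Integration.integral_nonneg) simp
        moreover have "sqrt ?I < 1 / (real n + 1)" using Vn[of n] by (simp add: L2norm_def)
        ultimately have "?I \<le> (1 / (real n + 1))\<^sup>2"
          using power_mono[of "sqrt ?I" "1 / (real n + 1)" 2] by simp
        then show ?thesis using \<open>?I \<ge> 0\<close> unfolding eq by simp
      qed
      then show "(\<lambda>n. \<integral>x. (cmod (control_state T (u n) x - ?f x))\<^sup>2 \<partial>lebesgue) \<longlonglongrightarrow> 0"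
        by (intro Lim_null_comparison[OF always_eventually z] allI)
    qed
  qed
  moreover have "approx_controllable T W0 WT" if f: "?f \<in> H_radial"
    unfolding approx_controllable_def H0_closure_def
  proof (intro CollectI conjI allI impI assms(3))
    fix \<epsilon> :: real assume \<epsilon>: "\<epsilon> > 0"
    obtain u where u: "u \<in> Linf (lebesgue_on {0<..<T})"
      and ue: "(\<integral>x. (cmod (control_state T u x - ?f x))\<^sup>2 \<partial>lebesgue) < \<epsilon>\<^sup>2"
      using approximableD[OF approximable_H_radial[OF T f], of "\<epsilon>\<^sup>2"] \<epsilon> by auto
    have fL2: "?f \<in> L2 lebesgue" using f by (simp add: H_radial_def)
    let ?V = "\<lambda>x. F x + control_state T u x"
    have "(\<lambda>x. (WT x - ?f x) + control_state T u x) \<in> L2 lebesgue"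
      by (intro L2_add L2_diff[OF WT fL2] control_state_L2 T u)
    then have "?V \<in> L2 lebesgue" by simp
    \<comment> \<open>The free state is \<open>WT - ?f\<close>, so its evenness comes from that of
      \<open>WT\<close> and of the radial function \<open>?f\<close>; the controlled part depends on
      the norm alone.\<close>
    moreover have "AE x in lebesgue. ?V (reflect1 x) = ?V x"
      using WTe H_radial_even[OF f] by eventually_elim (simp add: control_state_eq_profile norm_reflect1)
    ultimately have "?V \<in> reachable T W0"
      using u by (auto simp: reachable_def H0_hat_def free_state_def F_def)
    moreover have "L2norm lebesgue (\<lambda>x. ?V x - WT x) < \<epsilon>"
    proof -
      have "L2norm lebesgue (\<lambda>x. ?V x - WT x) = sqrt (\<integral>x. (cmod (control_state T u x - ?f x))\<^sup>2 \<partial>lebesgue)"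
        by (simp add: L2norm_def algebra_simps)
      also have "\<dots> < sqrt (\<epsilon>\<^sup>2)" using ue by (rule real_sqrt_less_mono)
      finally show ?thesis using \<epsilon> by simp
    qed
    ultimately show "\<exists>V\<in>reachable T W0. L2norm lebesgue (\<lambda>x. V x - WT x) < \<epsilon>"
      by (intro bexI[of _ ?V])
  qed
  ultimately show ?thesis unfolding F_def by blast
qed

end
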